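(* Let $X$ be a generic $n\times m$ generalized diagonal matrix such that the ladders of zeros $L_1$ and $L_2$ are triangles of size $t_1$ and $t_2$, respectively. Let $1\le r\le\min(n,m)$, $I=I_r(X)$, let $\Delta_I$ be the Stanley–Reisner complex of the initial ideal of $I$, and let $d=\dim\Delta_I$. Set $T_1=\max\{r-2,t_1\}$ and $T_2=\max\{r-2,t_2\}$. Then $$f_d(\Delta_I)=\sum_{\substack{1\le a_1<\dots<a_{r-1}\le T_1+1\\ 1\le b_1<\dots<b_{r-1}\le T_2+1}}\det\big[h_{ij}\big]_{1\le i,j\le r-1},$$ where $$h_{ij}=\begin{cases}\displaystyle\binom{n+m-T_1-T_2-2}{m-1-T_2+b_j-a_i} & \text{if } T_2-m+1\le b_j-a_i\le n-1-T_1,\\[2mm] 0 & \text{otherwise.}\end{cases}$$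
   Context: A generalized diagonal (GD) matrix is an $n\times m$ matrix with two ladders of zeros, $L_1$ (bottom left) and $L_2$ (top right): given positive integers $c_1\ge\dots\ge c_s$ with $s<m$, $c_1<n$, $L_1$ consists of the last $c_i$ entries of column $i$ for $i=1,\dots,s$; given positive integers $d_t\le\dots\le d_m$ with $t>1$, $d_m<n$, $L_2$ consists of the first $d_i$ entries of column $i$ for $i=t,\dots,m$; either ladder may be empty. It is generic if the entries outside $L_1\cup L_2$ are distinct indeterminates $x_{ij}$ over a field $k$; $R=k[X]$ is the polynomial ring in these entries. $L_1$ is a triangle of size $t_1\ge 0$ if $c_1=t_1,\ c_2=t_1-1,\dots,c_{t_1}=1$ (positions $(i,j)$ with $i-j\ge n-t_1$); $L_2$ is a triangle of size $t_2\ge 0$ if $d_{m-t_2+1}=1,\dots,d_m=t_2$ (positions with $j-i\ge m-t_2$); size $0$ means empty. $I_r(X)$ is the ideal of $r\times r$ minors of $X$. The monomial order on $R$ is lexicographic with $x_{ij}>x_{kl}$ if $i<k$, or $i=k$ and $j<l$. The initial ideal $\mathrm{in}(I)$ is square-free. $\Delta_I$ is the simplicial complex with vertices labeled by the non-zero entries of $X$ whose faces are the sets of entries whose product is not in $\mathrm{in}(I)$. $f_j(\Delta_I)$ denotes the number of faces of $\Delta_I$ of dimension $j$ (i.e. of cardinality $j+1$); for $d=\dim\Delta_I$, the number $f_d(\Delta_I)$ is the multiplicity of $R/I$. *)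

theory Defs
  imports
    "Jordan_Normal_Form.Determinant"
    "Jordan_Normal_Form.DL_Submatrix"
    "HOL-Algebra.Ideal"
    "HOL-Library.Poly_Mapping"
    "HOL-Library.Product_Lexorder"
begin

text \<open>
  Polynomials in the indeterminates \<open>x\<^bsub>(i,j)\<^esub>\<close>, represented as finitely supported functions from
  monomials (exponent vectors) to coefficients. Rows and columns are numbered from \<open>0\<close>, as for
  \<^typ>\<open>'a mat\<close>; this shift does not affect the monomial order or the shape of the ladders.
\<close>

type_synonym monom = "nat \<times> nat \<Rightarrow>\<^sub>0 nat"
type_synonym 'k pring = "monom \<Rightarrow>\<^sub>0 'k"

definition indet :: "nat \<times> nat \<Rightarrow> 'k::field pring" where
  "indet v = Poly_Mapping.single (Poly_Mapping.single v 1) 1"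

text \<open>The polynomial ring \<open>k[x\<^sub>v : v \<in> V]\<close>.\<close>

definition poly_ring_in :: "(nat \<times> nat) set \<Rightarrow> 'k::field pring ring" where
  "poly_ring_in V =
     \<lparr>carrier = {p. \<forall>u \<in> Poly_Mapping.keys p. Poly_Mapping.keys u \<subseteq> V},
      mult = (*), one = 1, zero = 0, add = (+)\<rparr>"

text \<open>
  In the first \<open>s = length c\<close> columns, the last \<open>c\<^sub>j\<close> entries of column \<open>j\<close> vanish; in the last
  \<open>length d\<close> columns, the first \<open>d\<^sub>j\<close> entries of column \<open>j\<close> vanish. The list \<open>d\<close> holds
  \<open>d\<^sub>t, \<dots>, d\<^sub>m\<close>, so that \<open>length d = m - t + 1\<close> and \<open>t > 1\<close> reads \<open>length d < m\<close>.
\<close>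

definition gd_shape :: "nat \<Rightarrow> nat \<Rightarrow> nat list \<Rightarrow> nat list \<Rightarrow> bool" where
  "gd_shape n m c d \<longleftrightarrow>
     sorted_wrt (\<ge>) c \<and> (\<forall>x \<in> set c. 0 < x \<and> x < n) \<and> length c < m \<and>
     sorted_wrt (\<le>) d \<and> (\<forall>x \<in> set d. 0 < x \<and> x < n) \<and> length d < m"

definition ladder1 :: "nat \<Rightarrow> nat list \<Rightarrow> (nat \<times> nat) set" where
  "ladder1 n c = {(i, j). j < length c \<and> n - c ! j \<le> i \<and> i < n}"

definition ladder2 :: "nat \<Rightarrow> nat list \<Rightarrow> (nat \<times> nat) set" where
  "ladder2 m d = {(i, j). m - length d \<le> j \<and> j < m \<and> i < d ! (j - (m - length d))}"

definition triangle1 :: "nat \<Rightarrow> nat list \<Rightarrow> bool" where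
  "triangle1 t c \<longleftrightarrow> length c = t \<and> (\<forall>i < t. c ! i = t - i)"

definition triangle2 :: "nat \<Rightarrow> nat list \<Rightarrow> bool" where
  "triangle2 t d \<longleftrightarrow> length d = t \<and> (\<forall>i < t. d ! i = i + 1)"

definition nonzero_entries :: "nat \<Rightarrow> nat \<Rightarrow> nat list \<Rightarrow> nat list \<Rightarrow> (nat \<times> nat) set" where
  "nonzero_entries n m c d = {..<n} \<times> {..<m} - (ladder1 n c \<union> ladder2 m d)"

definition generic_gd_matrix ::
    "nat \<Rightarrow> nat \<Rightarrow> nat list \<Rightarrow> nat list \<Rightarrow> 'k::field pring mat" where
  "generic_gd_matrix n m c d =
     mat n m (\<lambda>p. if p \<in> nonzero_entries n m c d then indet p else 0)"

definition minors :: "nat \<Rightarrow> 'a::comm_ring_1 mat \<Rightarrow> 'a set" where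
  "minors r A = {det (submatrix A I J) | I J.
     I \<subseteq> {..<dim_row A} \<and> J \<subseteq> {..<dim_col A} \<and> card I = r \<and> card J = r}"

definition minor_ideal :: "(nat \<times> nat) set \<Rightarrow> nat \<Rightarrow> 'k::field pring mat \<Rightarrow> 'k pring set" where
  "minor_ideal V r A = genideal (poly_ring_in V) (minors r A)"

text \<open>
  The order on \<^typ>\<open>monom\<close> compares the exponents at the least index \<open>(i,j)\<close>, in the
  lexicographic order on pairs, at which two monomials differ. It is thus the lexicographic
  monomial order for which \<open>x\<^bsub>(i,j)\<^esub> > x\<^bsub>(k,l)\<^esub>\<close> iff \<open>i < k\<close>, or \<open>i = k\<close> and \<open>j < l\<close>.
\<close>

lemma monom_less_iff:
  fixes u v :: monom
  shows "u < v \<longleftrightarrow> (\<exists>i j. Poly_Mapping.lookup u (i, j) < Poly_Mapping.lookup v (i, j) \<and>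
    (\<forall>k l. k < i \<or> k = i \<and> l < j \<longrightarrow> Poly_Mapping.lookup u (k, l) = Poly_Mapping.lookup v (k, l)))"
  by (auto simp: less_poly_mapping.rep_eq less_fun_def less_prod_def')

lemma single_less_single_iff:
  "(Poly_Mapping.single (k, l) 1 :: monom) < Poly_Mapping.single (i, j) 1
     \<longleftrightarrow> i < k \<or> i = k \<and> j < l"
    (is "?u < ?v \<longleftrightarrow> ?R")
proof
  assume "?u < ?v"
  then obtain i' j' where
      lt: "Poly_Mapping.lookup ?u (i', j') < Poly_Mapping.lookup ?v (i', j')"
    and eq: "\<And>k' l'. k' < i' \<or> k' = i' \<and> l' < j' \<Longrightarrow>
      Poly_Mapping.lookup ?u (k', l') = Poly_Mapping.lookup ?v (k', l')"
    unfolding monom_less_iff by blast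
  from lt have ij: "i' = i" "j' = j" and ne: "(k, l) \<noteq> (i, j)"
    by (auto simp: lookup_single when_def split: if_splits)
  have "\<not> (k < i \<or> k = i \<and> l < j)"
    using eq[of k l] ne by (auto simp: ij lookup_single when_def)
  then show ?R
    using ne by auto
next
  assume ?R
  then show "?u < ?v"
    unfolding monom_less_iff
    by (intro exI[of _ i] exI[of _ j]) (auto simp: lookup_single when_def)
qed

definition lead_monom :: "'k::field pring \<Rightarrow> monom" where
  "lead_monom p = Max (Poly_Mapping.keys p)"

definition initial_ideal :: "(nat \<times> nat) set \<Rightarrow> 'k::field pring set \<Rightarrow> 'k pring set" where
  "initial_ideal V I =
     genideal (poly_ring_in V) {Poly_Mapping.single (lead_monom p) 1 | p. p \<in> I \<and> p \<noteq> 0}"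

definition initial_complex ::
    "(nat \<times> nat) set \<Rightarrow> 'k::field pring set \<Rightarrow> (nat \<times> nat) set set" where
  "initial_complex V I = {F. F \<subseteq> V \<and> (\<Prod>v\<in>F. indet v) \<notin> initial_ideal V I}"

text \<open>The empty face has dimension \<open>-1\<close>.\<close>

definition face_dim :: "'a set \<Rightarrow> int" where
  "face_dim F = int (card F) - 1"

definition complex_dim :: "'a set set \<Rightarrow> int" where
  "complex_dim \<Delta> = Max (face_dim ` \<Delta>)"

definition face_number :: "int \<Rightarrow> 'a set set \<Rightarrow> nat" where
  "face_number j \<Delta> = card {F \<in> \<Delta>. face_dim F = j}"

definition increasing_seqs :: "nat \<Rightarrow> int \<Rightarrow> int list set" where
  "increasing_seqs k N = {a. length a = k \<and> sorted_wrt (<) a \<and> set a \<subseteq> {1..N}}"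

text \<open>
  In the first case both arguments of the binomial coefficient are nonnegative, so the
  conversion to \<^typ>\<open>nat\<close> does not truncate.
\<close>

definition h_entry :: "int \<Rightarrow> int \<Rightarrow> int \<Rightarrow> int \<Rightarrow> int \<Rightarrow> int \<Rightarrow> int" where
  "h_entry n m T1 T2 a b =
     (if T2 - m + 1 \<le> b - a \<and> b - a \<le> n - 1 - T1
      then int (nat (n + m - T1 - T2 - 2) choose nat (m - 1 - T2 + b - a))
      else 0)"

end

theory Submission
  imports Defs
begin

text \<open>
  The initial ideal is never determined completely. For the number of faces of top dimension it
  suffices to decide which sets of entries of the largest possible cardinality are faces, and this
  follows from two elementary observations.

  Call \<open>r\<close> entries a chain if each is strictly below and strictly to the right of the one before. If a
  set \<open>F\<close> of nonzero entries contains a chain, then \<open>F\<close> is not a face, because the product over the chain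
  is the leading monomial of a minor (\<open>chain_in_initial_ideal\<close>). The diagonals \<open>j - i = const\<close> of the matrix
  are chains, so a face has at most \<open>r - 1\<close> entries on each. This bounds its cardinality, and when the
  bound is attained the \<open>l\<close>-th entries on neighbouring diagonals must be neighbours in the matrix
  (\<open>diag_cols_step\<close>): the set is a disjoint union of \<open>r - 1\<close> lattice paths that run up and to the right,
  one through the \<open>l\<close>-th entries for each \<open>l\<close>.

  Conversely, such a union \<open>F\<close> of paths is a face. Attach an indeterminate \<open>y\<^sub>v\<close> to each \<open>v \<in> F\<close>. Each path
  extends uniquely to a rank-one matrix of Laurent monomials on its bounding box, which avoids the
  zeros of \<open>X\<close>. The sum of these \<open>r - 1\<close> matrices has rank less than \<open>r\<close>, so the ideal \<open>I\<close> vanishes on it.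
  In the lexicographic order the entry of the sum at \<open>v \<in> F\<close> has leading term \<open>y\<^sub>v\<close>, and the entries at
  \<open>v \<notin> F\<close> are smaller than an indeterminate with index \<open>v\<close> would be (\<open>rank_one_completion\<close>). Hence a
  polynomial whose leading monomial involves only entries of \<open>F\<close> does not vanish on it
  (\<open>laurent_eval_ne_0\<close>), and no element of \<open>I\<close> has such a leading monomial. This argument takes the place of
  the theorem that the minors form a Groebner basis.

  It remains to count the path families. Read diagonal by diagonal, they are systems of \<open>r - 1\<close> particles
  on a line that move by \<open>0\<close> or \<open>1\<close> in each step without colliding. For fixed initial positions \<open>a\<close> and
  final positions \<open>b\<close> their number is the determinant of the \<open>h\<^sub>i\<^sub>j\<close> (\<open>card_walks_eq_det\<close>), by Pascal's rule
  and the multilinearity of the determinant.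

  The maxima in \<open>T\<^sub>1\<close> and \<open>T\<^sub>2\<close> arise as follows. An entry in the triangle of size \<open>r - 2\<close> at the bottom
  left or top right corner is in no chain of length \<open>r\<close>, and so belongs to every face of top dimension if
  it is not zero. Only the remaining diagonals leave a choice.
\<close>

section \<open>Nonintersecting walks and increasing sequences\<close>

text \<open>
  The number of ways to choose the \<open>s\<close> moving steps among \<open>N\<close> steps. Extending it by zero to negative
  \<open>s\<close> makes Pascal's rule hold for every integer \<open>s\<close>.
\<close>

definition step_binom :: "nat \<Rightarrow> int \<Rightarrow> int" where
  "step_binom N s = (if 0 \<le> s then int (N choose nat s) else 0)"

lemma step_binom_Suc: "step_binom (Suc N) s = step_binom N s + step_binom N (s - 1)"
proof (cases "1 \<le> s")
  case True
  then obtain k where "s = int (Suc k)"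
    by (metis One_nat_def Suc_le_D nat_0_le of_nat_1 of_nat_le_iff order_trans zero_le_one)
  then show ?thesis by (simp add: step_binom_def nat_add_distrib)
next
  case False
  then show ?thesis by (cases "s = 0") (auto simp: step_binom_def)
qed

text \<open>
  Several particles on the integer line, listed from left to right: in one time step each stays or
  moves by one to the right, and no two may meet.
\<close>

definition one_step :: "int list \<Rightarrow> int list \<Rightarrow> bool" where
  "one_step x z \<longleftrightarrow> length z = length x \<and> sorted_wrt (<) z \<and> (\<forall>i < length x. z ! i - x ! i \<in> {0, 1})"

fun walks :: "nat \<Rightarrow> int list \<Rightarrow> int list \<Rightarrow> int list list set" where
  "walks 0 x y = (if x = y then {[x]} else {})"
| "walks (Suc N) x y = (\<Union>z \<in> {z. one_step x z}. (#) x ` walks N z y)"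

lemma det_mat_Leibniz:
  "det (mat k k (\<lambda>(i, j). g i j)) =
     (\<Sum>p | p permutes {0..<k}. signof p * (\<Prod>i = 0..<k. g i (p i)))"
proof -
  have "(\<Prod>i = 0..<k. mat k k (\<lambda>(i, j). g i j) $$ (i, p i)) = (\<Prod>i = 0..<k. g i (p i))"
    if "p permutes {0..<k}" for p
    using that by (intro prod.cong) (auto dest: permutes_in_image)
  then show ?thesis
    by (subst det_def'[of _ k]) auto
qed

lemma det_mat_zero_row:
  fixes g :: "nat \<Rightarrow> nat \<Rightarrow> 'a::comm_ring_1"
  assumes "i < k" "\<And>j. j < k \<Longrightarrow> g i j = 0"
  shows "det (mat k k (\<lambda>(i, j). g i j)) = 0"
proof -
  have "(\<Prod>i = 0..<k. g i (p i)) = 0" if "p permutes {0..<k}" for p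
  proof -
    have "p i < k" using that assms(1) permutes_in_image[OF that, of i] by auto
    then have "g i (p i) = 0" using assms(2) by blast
    then show ?thesis using assms(1) by (intro prod_zero) auto
  qed
  then show ?thesis unfolding det_mat_Leibniz by (intro sum.neutral) auto
qed

text \<open>
  Multilinearity in all rows at once.
\<close>

lemma det_mat_row_sums:
  "det (mat k k (\<lambda>(i, j). \<Sum>e \<in> E. g e i j)) =
     (\<Sum>\<epsilon> \<in> PiE {0..<k} (\<lambda>_. E). det (mat k k (\<lambda>(i, j). g (\<epsilon> i) i j)))"
  if "finite E"
proof -
  have "det (mat k k (\<lambda>(i, j). \<Sum>e \<in> E. g e i j)) =
      (\<Sum>p | p permutes {0..<k}. signof p * (\<Sum>\<epsilon> \<in> PiE {0..<k} (\<lambda>_. E). \<Prod>i = 0..<k. g (\<epsilon> i) i (p i)))"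
    unfolding det_mat_Leibniz using that by (subst prod_sum_PiE) auto
  also have "\<dots> = (\<Sum>\<epsilon> \<in> PiE {0..<k} (\<lambda>_. E). \<Sum>p | p permutes {0..<k}. signof p * (\<Prod>i = 0..<k. g (\<epsilon> i) i (p i)))"
    unfolding sum_distrib_left by (rule sum.swap)
  finally show ?thesis unfolding det_mat_Leibniz .
qed

lemma one_step_image:
  assumes "sorted_wrt (<) x"
  shows "{z. one_step x z} =
    {z \<in> (\<lambda>\<epsilon>. map (\<lambda>i. x ! i + \<epsilon> i) [0..<length x]) ` PiE {0..<length x} (\<lambda>_. {0, 1}). sorted_wrt (<) z}"
    (is "?A = {z \<in> ?f ` ?P. _}")
proof (intro equalityI subsetI)
  fix z assume z: "z \<in> ?A"
  define \<epsilon> where "\<epsilon> = (\<lambda>i\<in>{0..<length x}. z ! i - x ! i)"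
  have "\<epsilon> \<in> ?P" using z by (auto simp: \<epsilon>_def one_step_def)
  moreover have "z = ?f \<epsilon>" using z by (intro nth_equalityI) (auto simp: \<epsilon>_def one_step_def)
  ultimately show "z \<in> {z \<in> ?f ` ?P. sorted_wrt (<) z}" using z by (auto simp: one_step_def)
next
  fix z assume "z \<in> {z \<in> ?f ` ?P. sorted_wrt (<) z}"
  then show "z \<in> ?A" by (auto simp: one_step_def PiE_iff)
qed

lemma finite_one_step: "sorted_wrt (<) x \<Longrightarrow> finite {z. one_step x z}"
  by (subst one_step_image)
    (assumption, rule finite_subset[OF Collect_restrict], auto intro!: finite_PiE)

lemma finite_walks: "sorted_wrt (<) x \<Longrightarrow> finite (walks N x y)"
  by (induction N arbitrary: x) (auto simp: finite_one_step one_step_def)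

lemma hd_walks: "w \<in> walks N x y \<Longrightarrow> w \<noteq> [] \<and> hd w = x"
  by (cases N) (auto split: if_splits)

text \<open>
  Particles that start in strictly increasing order and move independently by at most one step can
  fail to be strictly increasing only because two neighbours coincide. The matrix then has two equal
  rows, so a collision contributes nothing to the determinant.
\<close>

lemma det_eq_0_of_not_strict:
  fixes x :: "int list" and g :: "int \<Rightarrow> nat \<Rightarrow> int"
  assumes x: "sorted_wrt (<) x" and k: "length x = k"
    and z: "length z = k" "\<forall>i<k. z ! i - x ! i \<in> {0, 1}" "\<not> sorted_wrt (<) z"
  shows "det (mat k k (\<lambda>(i, j). g (z ! i) j)) = 0"
proof -
  have "\<exists>i. Suc i < k \<and> \<not> z ! i < z ! Suc i"
    using z by (subst (asm) sorted_wrt_iff_nth_Suc_transp) auto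
  then obtain i where i: "Suc i < k" "\<not> z ! i < z ! Suc i" by blast
  have "x ! i < x ! Suc i" using x i k by (simp add: sorted_wrt_iff_nth_less)
  moreover have "z ! i - x ! i \<in> {0, 1}" "z ! Suc i - x ! Suc i \<in> {0, 1}" using z i by auto
  ultimately have eq: "z ! i = z ! Suc i" using i(2) by auto
  show ?thesis
    by (rule det_identical_rows[of _ k i "Suc i"]) (use i eq in \<open>auto intro!: eq_vecI\<close>)
qed

text \<open>
  The count of nonintersecting walks as a determinant of counts of single walks. Instead of a
  sign-reversing involution on path families, the proof follows the first time step: Pascal's rule
  splits each row in two, multilinearity turns this into a sum over all joint first moves, and
  \<open>det_eq_0_of_not_strict\<close> removes the moves that are not allowed.
\<close>

lemma card_walks_eq_det:
  assumes "sorted_wrt (<) x" "sorted_wrt (<) y" "length x = k" "length y = k"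
  shows "int (card (walks N x y)) = det (mat k k (\<lambda>(i, j). step_binom N (y ! j - x ! i)))"
  using assms(1,3)
proof (induction N arbitrary: x)
  case 0
  have b: "step_binom 0 s = (if s = 0 then 1 else 0)" for s
    by (auto simp: step_binom_def)
  show ?case
  proof (cases "x = y")
    case True
    have inj: "y ! j = y ! i \<longleftrightarrow> i = j" if "i < k" "j < k" for i j
      using assms(2,4) that strict_sorted_iff[of y] nth_eq_iff_index_eq[of y] by auto
    have "mat k k (\<lambda>(i, j). step_binom 0 (y ! j - x ! i)) = 1\<^sub>m k"
      using True inj by (intro eq_matI) (auto simp: b)
    then show ?thesis using True by simp
  next
    case False
    have "set x \<noteq> set y"
      using False 0 assms strict_sorted_equal[of x y] by auto
    moreover have "card (set x) = card (set y)"
      using 0 assms strict_sorted_iff distinct_card by metis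
    ultimately have "\<not> set x \<subseteq> set y"
      by (metis List.finite_set card_subset_eq)
    then obtain i where i: "i < k" "x ! i \<notin> set y"
      using 0 by (auto simp: set_conv_nth subset_iff)
    have "det (mat k k (\<lambda>(i, j). step_binom 0 (y ! j - x ! i))) = 0"
      by (rule det_mat_zero_row[of i]) (use i assms(4) in \<open>auto simp: b set_conv_nth\<close>)
    then show ?thesis using False by simp
  qed
next
  case (Suc N)
  define f where "f = (\<lambda>\<epsilon>. map (\<lambda>i. x ! i + \<epsilon> i) [0..<k])"
  define P where "P = PiE {0..<k} (\<lambda>_. {0, 1::int})"
  define dt where "dt = (\<lambda>z. det (mat k k (\<lambda>(i, j). step_binom N (y ! j - z ! i))))"
  have fP: "finite P" by (auto simp: P_def intro!: finite_PiE)
  have inj: "inj_on f P"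
  proof (rule inj_onI)
    fix e e' assume e: "e \<in> P" "e' \<in> P" "f e = f e'"
    have "e i = e' i" if "i < k" for i
      using arg_cong[OF e(3), of "\<lambda>l. l ! i"] that by (simp add: f_def)
    then show "e = e'" using e(1,2) unfolding P_def by (intro PiE_ext) auto
  qed
  have S: "{z. one_step x z} = {z \<in> f ` P. sorted_wrt (<) z}"
    using one_step_image[OF Suc.prems(1)] Suc.prems(2) by (simp add: f_def P_def)
  have "(\<lambda>(i, j). step_binom (Suc N) (y ! j - x ! i)) =
      (\<lambda>(i, j). \<Sum>e \<in> {0, 1}. step_binom N (y ! j - (x ! i + e)))"
    by (auto simp: step_binom_Suc algebra_simps)
  then have "det (mat k k (\<lambda>(i, j). step_binom (Suc N) (y ! j - x ! i))) =
      (\<Sum>\<epsilon> \<in> P. det (mat k k (\<lambda>(i, j). step_binom N (y ! j - (x ! i + \<epsilon> i)))))"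
    by (simp only: det_mat_row_sums P_def finite.intros)
  also have "\<dots> = (\<Sum>\<epsilon> \<in> P. dt (f \<epsilon>))"
    unfolding dt_def f_def
    by (intro sum.cong refl arg_cong[where f = det] eq_matI) auto
  also have "\<dots> = (\<Sum>z \<in> f ` P. dt z)"
    by (simp add: sum.reindex[OF inj])
  also have "\<dots> = (\<Sum>z | one_step x z. dt z)"
    unfolding S
  proof (rule sum.mono_neutral_right)
    show "\<forall>z \<in> f ` P - {z \<in> f ` P. sorted_wrt (<) z}. dt z = 0"
    proof
      fix z assume "z \<in> f ` P - {z \<in> f ` P. sorted_wrt (<) z}"
      then have "length z = k" "\<forall>i<k. z ! i - x ! i \<in> {0, 1}" "\<not> sorted_wrt (<) z"
        by (auto simp: f_def P_def PiE_iff)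
      then show "dt z = 0"
        unfolding dt_def
        using det_eq_0_of_not_strict[OF Suc.prems, of z "\<lambda>a j. step_binom N (y ! j - a)"] by simp
    qed
  qed (use fP in auto)
  also have "\<dots> = (\<Sum>z | one_step x z. int (card (walks N z y)))"
    using Suc.IH Suc.prems by (intro sum.cong) (auto simp: dt_def one_step_def)
  also have "\<dots> = int (card (walks (Suc N) x y))"
  proof -
    have "card (\<Union>z \<in> {z. one_step x z}. (#) x ` walks N z y) =
        (\<Sum>z | one_step x z. card ((#) x ` walks N z y))"
      using finite_one_step[OF Suc.prems(1)]
      by (intro card_UN_disjoint) (auto simp: one_step_def finite_walks dest: hd_walks)
    also have "\<dots> = (\<Sum>z | one_step x z. card (walks N z y))"
      by (intro sum.cong card_image) auto
    finally show ?thesis by simp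
  qed
  finally show ?case ..
qed

lemma walks_iff:
  "ws \<in> walks N x y \<longleftrightarrow> length ws = Suc N \<and> ws ! 0 = x \<and> ws ! N = y \<and> (\<forall>t<N. one_step (ws ! t) (ws ! Suc t))"
proof (induction N arbitrary: x ws)
  case 0
  then show ?case by (cases ws) auto
next
  case (Suc N)
  show ?case
  proof (cases ws)
    case (Cons v vs)
    have "ws \<in> walks (Suc N) x y \<longleftrightarrow> v = x \<and> one_step x (vs ! 0) \<and> vs \<in> walks N (vs ! 0) y"
    proof -
      have "ws \<in> walks (Suc N) x y \<longleftrightarrow> v = x \<and> (\<exists>z. one_step x z \<and> vs \<in> walks N z y)"
        by (auto simp: Cons)
      also have "(\<exists>z. one_step x z \<and> vs \<in> walks N z y) \<longleftrightarrow> one_step x (vs ! 0) \<and> vs \<in> walks N (vs ! 0) y"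
        by (auto simp: Suc)
      finally show ?thesis .
    qed
    then show ?thesis by (auto simp: Suc Cons less_Suc_eq_0_disj)
  qed auto
qed

text \<open>
  When the interval has only \<open>k\<close> elements, there is only one choice. This is the situation at a corner
  whose triangle of zeros is smaller than \<open>r - 2\<close>.
\<close>

lemma increasing_seqs_full:
  assumes "a \<in> increasing_seqs k (int k)" "l < k"
  shows "a ! l = int l + 1"
proof -
  have a: "length a = k" "sorted_wrt (<) a" "set a \<subseteq> {1..int k}"
    using assms by (auto simp: increasing_seqs_def)
  have mem: "1 \<le> a ! i \<and> a ! i \<le> int k" if "i < k" for i
    using subsetD[OF a(3) nth_mem[of i a]] that a(1) by simp
  have lo: "int i + 1 \<le> a ! i" if "i < k" for i
    using that
  proof (induction i)
    case 0
    then show ?case using mem[of 0] by simp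
  next
    case (Suc i)
    have "a ! i < a ! Suc i" using a Suc.prems by (simp add: sorted_wrt_iff_nth_less)
    then show ?case using Suc by simp
  qed
  have "a ! (k - 1 - i) \<le> int k - int i" if "i < k" for i
    using that
  proof (induction i)
    case 0
    then show ?case using mem[of "k - 1"] by simp
  next
    case (Suc i)
    have "a ! (k - 1 - Suc i) < a ! (k - 1 - i)"
      using a(1,2) Suc.prems by (simp add: sorted_wrt_iff_nth_less)
    then show ?case using Suc by simp
  qed
  from this[of "k - 1 - l"] lo[OF assms(2)] assms(2) show ?thesis by auto
qed

lemma finite_increasing_seqs: "finite (increasing_seqs k M)"
  by (rule finite_subset[OF _ finite_lists_length_eq[of "{1..M}" k]]) (auto simp: increasing_seqs_def)

section \<open>Rank-one matrices along lattice paths\<close>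

text \<open>
  Exponents of Laurent monomials. They are compared lexicographically in the same way as the
  exponents of ordinary monomials, and form a linearly ordered group.
\<close>

type_synonym expo = "nat \<times> nat \<Rightarrow>\<^sub>0 int"

lemma poly_mapping_lessI:
  fixes u w :: "'a::linorder \<Rightarrow>\<^sub>0 'b::{zero,linorder}"
  assumes "Poly_Mapping.lookup u v < Poly_Mapping.lookup w v"
    and "\<And>v'. v' < v \<Longrightarrow> Poly_Mapping.lookup u v' = Poly_Mapping.lookup w v'"
  shows "u < w"
  using assms by (auto simp: less_poly_mapping.rep_eq less_fun_def)

text \<open>
  Each step goes one column to the right or one row up, so a path runs from the bottom left corner to
  the top right corner of its bounding box.
\<close>

definition lattice_path :: "(nat \<Rightarrow> nat \<times> nat) \<Rightarrow> nat \<Rightarrow> bool" where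
  "lattice_path p L \<longleftrightarrow> (\<forall>t < L. p (Suc t) = (fst (p t), Suc (snd (p t))) \<or>
     p t = (Suc (fst (p (Suc t))), snd (p (Suc t))))"

lemma lattice_path_mono:
  assumes "lattice_path p L" "s \<le> t" "t \<le> L"
  shows "fst (p t) \<le> fst (p s) \<and> snd (p s) \<le> snd (p t)"
  using assms(2,3)
proof (induction t rule: dec_induct)
  case (step t)
  then have "p (Suc t) = (fst (p t), Suc (snd (p t))) \<or>
     p t = (Suc (fst (p (Suc t))), snd (p (Suc t)))"
    using assms(1) by (auto simp: lattice_path_def)
  then have "fst (p (Suc t)) \<le> fst (p t) \<and> snd (p t) \<le> snd (p (Suc t))"
    by (auto simp: prod_eq_iff)
  then show ?case using step by force
qed simp

text \<open>
  A path is a spanning tree of the bipartite graph of its rows and columns. Prescribing an indeterminate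
  at each of its entries therefore determines a rank-one matrix of Laurent monomials on the bounding
  box, with exponents \<open>\<alpha> i + \<beta> j\<close>. The point is that an entry off the path is smaller than the
  indeterminate that carries its index. Above the path this holds because the entry only involves
  indeterminates that come later in the order; below the path because the earliest indeterminate that
  it involves has exponent \<open>- 1\<close>. The last two clauses make an induction on the length
  possible: they say which exponents vanish, and that passing from the top row to a lower one lowers
  the exponent at an index in the top row.
\<close>

lemma rank_one_completion:
  assumes "lattice_path p L"
  shows "\<exists>\<alpha> \<beta> :: nat \<Rightarrow> expo.
    (\<forall>i \<in> {fst (p L)..fst (p 0)}. \<forall>j \<in> {snd (p 0)..snd (p L)}.
       ((i, j) \<in> p ` {..L} \<longrightarrow> \<alpha> i + \<beta> j = Poly_Mapping.single (i, j) 1) \<and>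
       ((i, j) \<notin> p ` {..L} \<longrightarrow> \<alpha> i + \<beta> j < Poly_Mapping.single (i, j) 1) \<and>
       (\<forall>v. fst v < fst (p L) \<longrightarrow> Poly_Mapping.lookup (\<alpha> i + \<beta> j) v = 0)) \<and>
    (\<forall>i \<in> {fst (p L)<..fst (p 0)}. \<exists>c \<le> snd (p L).
       Poly_Mapping.lookup (\<alpha> i - \<alpha> (fst (p L))) (fst (p L), c) < 0 \<and>
       (\<forall>v < (fst (p L), c). Poly_Mapping.lookup (\<alpha> i - \<alpha> (fst (p L))) v = 0))"
  using assms
proof (induction L)
  case 0
  show ?case
    by (rule exI[of _ "\<lambda>_. Poly_Mapping.single (p 0) 1"], rule exI[of _ "\<lambda>_. 0"], cases "p 0")
      (auto simp: lookup_single when_def)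
next
  case (Suc L)
  have path: "lattice_path p L" using Suc.prems by (auto simp: lattice_path_def)
  define a where "a = fst (p L)"
  define b where "b = snd (p L)"
  define i0 where "i0 = fst (p 0)"
  define j0 where "j0 = snd (p 0)"
  have ab: "a \<le> i0" "j0 \<le> b" and pL: "p L = (a, b)"
    using lattice_path_mono[OF path, of 0 L] by (auto simp: a_def b_def i0_def j0_def)
  have P: "i \<ge> a \<and> j \<le> b" if ij: "(i, j) \<in> p ` {..L}" for i j
  proof -
    obtain t where t: "t \<le> L" "(i, j) = p t" using ij by blast
    show ?thesis using lattice_path_mono[OF path t(1) order_refl] by (simp add: a_def b_def flip: t(2))
  qed
  have img: "p ` {..Suc L} = insert (p (Suc L)) (p ` {..L})"
    by (auto simp: atMost_Suc)
  obtain \<alpha> \<beta> :: "nat \<Rightarrow> expo" where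
    IH1: "\<forall>i \<in> {a..i0}. \<forall>j \<in> {j0..b}.
       ((i, j) \<in> p ` {..L} \<longrightarrow> \<alpha> i + \<beta> j = Poly_Mapping.single (i, j) 1) \<and>
       ((i, j) \<notin> p ` {..L} \<longrightarrow> \<alpha> i + \<beta> j < Poly_Mapping.single (i, j) 1) \<and>
       (\<forall>v. fst v < a \<longrightarrow> Poly_Mapping.lookup (\<alpha> i + \<beta> j) v = 0)" and
    IH2: "\<forall>i \<in> {a<..i0}. \<exists>c \<le> b. Poly_Mapping.lookup (\<alpha> i - \<alpha> a) (a, c) < 0 \<and>
       (\<forall>v < (a, c). Poly_Mapping.lookup (\<alpha> i - \<alpha> a) v = 0)"
    using Suc.IH[OF path] unfolding a_def b_def i0_def j0_def by blast
  have on: "\<alpha> i + \<beta> j = Poly_Mapping.single (i, j) 1"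
    if "i \<in> {a..i0}" "j \<in> {j0..b}" "(i, j) \<in> p ` {..L}" for i j
    using IH1 that by blast
  have off: "\<alpha> i + \<beta> j < Poly_Mapping.single (i, j) 1"
    if "i \<in> {a..i0}" "j \<in> {j0..b}" "(i, j) \<notin> p ` {..L}" for i j
    using IH1 that by blast
  have row: "Poly_Mapping.lookup (\<alpha> i) v + Poly_Mapping.lookup (\<beta> j) v = 0"
    if "i \<in> {a..i0}" "j \<in> {j0..b}" "fst v < a" for i j v
    using IH1 that unfolding lookup_add by blast
  have fall: "\<exists>c \<le> b. Poly_Mapping.lookup (\<alpha> i) (a, c) < Poly_Mapping.lookup (\<alpha> a) (a, c) \<and>
       (\<forall>v < (a, c). Poly_Mapping.lookup (\<alpha> i) v = Poly_Mapping.lookup (\<alpha> a) v)"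
    if "i \<in> {a<..i0}" for i
    using bspec[OF IH2 that] by (simp only: lookup_minus diff_less_0_iff_less right_minus_eq)
  have "p (Suc L) = (a, Suc b) \<or> (\<exists>a'. a = Suc a' \<and> p (Suc L) = (a', b))"
  proof -
    have "p (Suc L) = (fst (p L), Suc (snd (p L))) \<or> p L = (Suc (fst (p (Suc L))), snd (p (Suc L)))"
      using Suc.prems unfolding lattice_path_def by blast
    then show ?thesis by (cases "p (Suc L)") (auto simp: pL)
  qed
  then show ?case
  proof (elim disjE exE conjE)
    assume p: "p (Suc L) = (a, Suc b)"
    \<comment> \<open>A step to the right opens a new column, whose entry in the top row is prescribed.\<close>
    define \<beta>' where "\<beta>' = \<beta>(Suc b := Poly_Mapping.single (a, Suc b) 1 - \<alpha> a)"
    have 1: "\<alpha> i + \<beta>' (Suc b) < Poly_Mapping.single (i, Suc b) 1" if i: "i \<in> {a<..i0}" for i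
    proof -
      obtain c where c: "c \<le> b" "Poly_Mapping.lookup (\<alpha> i) (a, c) < Poly_Mapping.lookup (\<alpha> a) (a, c)"
        "\<forall>v < (a, c). Poly_Mapping.lookup (\<alpha> i) v = Poly_Mapping.lookup (\<alpha> a) v"
        using fall i by blast
      show ?thesis
        by (rule poly_mapping_lessI[of _ "(a, c)"])
          (use c i in \<open>auto simp: \<beta>'_def lookup_add lookup_minus lookup_single when_def\<close>)
    qed
    have 2: "Poly_Mapping.lookup (\<alpha> i + \<beta>' (Suc b)) v = 0" if "i \<in> {a..i0}" "fst v < a" for i v
    proof -
      have "Poly_Mapping.lookup (\<alpha> i) v + Poly_Mapping.lookup (\<beta> b) v = Poly_Mapping.lookup (\<alpha> a) v + Poly_Mapping.lookup (\<beta> b) v"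
        using row[of i b v] row[of a b v] ab that by auto
      then show ?thesis using that
        by (auto simp: \<beta>'_def lookup_add lookup_minus lookup_single when_def)
    qed
    show ?thesis
    proof (rule exI[of _ \<alpha>], rule exI[of _ \<beta>'], unfold p fst_conv snd_conv i0_def[symmetric] j0_def[symmetric], intro conjI ballI)
      fix i j assume ij: "i \<in> {a..i0}" "j \<in> {j0..Suc b}"
      show "(i, j) \<in> p ` {..Suc L} \<longrightarrow> \<alpha> i + \<beta>' j = Poly_Mapping.single (i, j) 1"
        using on[of i j] ij P[of i j] by (auto simp: img p \<beta>'_def)
      show "(i, j) \<notin> p ` {..Suc L} \<longrightarrow> \<alpha> i + \<beta>' j < Poly_Mapping.single (i, j) 1"
        using off[of i j] ij 1[of i] by (cases "j = Suc b") (auto simp: img p \<beta>'_def)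
      show "\<forall>v. fst v < a \<longrightarrow> Poly_Mapping.lookup (\<alpha> i + \<beta>' j) v = 0"
        using row[of i j] ij 2[of i] by (cases "j = Suc b") (auto simp: \<beta>'_def lookup_add)
    next
      fix i assume "i \<in> {a<..i0}"
      then show "\<exists>c\<le>Suc b.
            Poly_Mapping.lookup (\<alpha> i - \<alpha> a) (a, c) < 0 \<and>
            (\<forall>v<(a, c). Poly_Mapping.lookup (\<alpha> i - \<alpha> a) v = 0)"
        using IH2 le_SucI by blast
    qed
  next
    fix a' assume a': "a = Suc a'" and p: "p (Suc L) = (a', b)"
    \<comment> \<open>A step up opens a new top row, whose entry in the last column is prescribed.\<close>
    define \<alpha>' where "\<alpha>' = \<alpha>(a' := Poly_Mapping.single (a', b) 1 - \<beta> b)"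
    \<comment> \<open>The old top row \<open>a\<close> is used to compare columns: its entries have exponent \<open>0\<close> in all rows above.\<close>
    have same: "Poly_Mapping.lookup (\<beta> j) v = Poly_Mapping.lookup (\<beta> b) v" if "j \<in> {j0..b}" "fst v \<le> a'" for j v
      using row[of a j v] row[of a b v] that a' ab by auto
    have 1: "\<alpha>' a' + \<beta> j < Poly_Mapping.single (a', j) 1" if "j \<in> {j0..<b}" for j
      by (rule poly_mapping_lessI[of _ "(a', j)"])
        (use that same[of j] in \<open>auto simp: \<alpha>'_def lookup_add lookup_minus lookup_single when_def\<close>)
    show ?thesis
    proof (rule exI[of _ \<alpha>'], rule exI[of _ \<beta>], unfold p fst_conv snd_conv i0_def[symmetric] j0_def[symmetric], intro conjI ballI)
      fix i j assume ij: "i \<in> {a'..i0}" "j \<in> {j0..b}"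
      show "(i, j) \<in> p ` {..Suc L} \<longrightarrow> \<alpha>' i + \<beta> j = Poly_Mapping.single (i, j) 1"
        using on[of i j] ij P[of i j] a' by (auto simp: img p \<alpha>'_def)
      show "(i, j) \<notin> p ` {..Suc L} \<longrightarrow> \<alpha>' i + \<beta> j < Poly_Mapping.single (i, j) 1"
        using off[of i j] ij 1[of j] a' by (cases "i = a'") (auto simp: img p \<alpha>'_def)
      show "\<forall>v. fst v < a' \<longrightarrow> Poly_Mapping.lookup (\<alpha>' i + \<beta> j) v = 0"
        using row[of i j] ij same[of j] a'
        by (cases "i = a'") (auto simp: \<alpha>'_def lookup_add lookup_minus lookup_single when_def)
    next
      fix i assume i: "i \<in> {a'<..i0}"
      show "\<exists>c\<le>b.
            Poly_Mapping.lookup (\<alpha>' i - \<alpha>' a') (a', c) < 0 \<and>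
            (\<forall>v<(a', c). Poly_Mapping.lookup (\<alpha>' i - \<alpha>' a') v = 0)"
      proof (intro exI[of _ b] conjI allI impI)
        have z: "Poly_Mapping.lookup (\<alpha> i) v + Poly_Mapping.lookup (\<beta> b) v = 0" if "fst v \<le> a'" for v
          using row[of i b v] i that a' ab by auto
        show "Poly_Mapping.lookup (\<alpha>' i - \<alpha>' a') (a', b) < 0"
          using z[of "(a', b)"] i by (auto simp: \<alpha>'_def lookup_minus)
        fix v assume "v < (a', b)"
        then show "Poly_Mapping.lookup (\<alpha>' i - \<alpha>' a') v = 0"
          using z[of v] i by (cases v) (auto simp: \<alpha>'_def lookup_minus lookup_single when_def less_prod_def')
      qed simp
    qed
  qed
qed

section \<open>Leading terms under substitution of Laurent polynomials\<close>

lemma poly_ring_in_ops: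
  "p \<otimes>\<^bsub>poly_ring_in V\<^esub> q = p * q" "p \<oplus>\<^bsub>poly_ring_in V\<^esub> q = p + q"
  "\<one>\<^bsub>poly_ring_in V\<^esub> = 1" "\<zero>\<^bsub>poly_ring_in V\<^esub> = 0"
  by (simp_all add: poly_ring_in_def)

lemma ring_poly_ring_in: "ring (poly_ring_in V :: 'k::field pring ring)"
proof (rule ringI)
  let ?R = "poly_ring_in V :: 'k pring ring"
  show "abelian_group ?R"
  proof (rule abelian_groupI)
    fix x assume "x \<in> carrier ?R"
    then show "\<exists>y\<in>carrier ?R. y \<oplus>\<^bsub>?R\<^esub> x = \<zero>\<^bsub>?R\<^esub>"
      by (intro bexI[of _ "- x"]) (auto simp: poly_ring_in_def)
  qed (use keys_add in \<open>fastforce simp: poly_ring_in_def algebra_simps\<close>)+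
  have closed: "p * q \<in> carrier ?R" if pq: "p \<in> carrier ?R" "q \<in> carrier ?R" for p q
  proof -
    have "Poly_Mapping.keys w \<subseteq> V" if w: "w \<in> Poly_Mapping.keys (p * q)" for w
    proof -
      obtain u v where uv: "w = u + v" "u \<in> Poly_Mapping.keys p" "v \<in> Poly_Mapping.keys q"
        using keys_mult[of p q] w by blast
      then have "Poly_Mapping.keys u \<subseteq> V" "Poly_Mapping.keys v \<subseteq> V"
        using pq by (auto simp: poly_ring_in_def)
      then show ?thesis using keys_add[of u v] uv(1) by blast
    qed
    then show ?thesis by (simp add: poly_ring_in_def)
  qed
  have "1 \<in> carrier ?R" by (simp add: poly_ring_in_def)
  with closed show "Group.monoid ?R"
    by (intro Group.monoidI) (simp_all add: poly_ring_in_ops mult.assoc)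
qed (auto simp: poly_ring_in_def algebra_simps)

lemma ideal_poly_ring_inI:
  fixes K :: "'k::field pring set"
  assumes "K \<subseteq> carrier (poly_ring_in V)" "0 \<in> K"
    and add: "\<And>p q. p \<in> K \<Longrightarrow> q \<in> K \<Longrightarrow> p + q \<in> K"
    and mult: "\<And>p q. p \<in> carrier (poly_ring_in V) \<Longrightarrow> q \<in> K \<Longrightarrow> p * q \<in> K"
  shows "ideal K (poly_ring_in V)"
proof -
  let ?R = "poly_ring_in V :: 'k pring ring"
  interpret R: ring ?R by (rule ring_poly_ring_in)
  have *: "- 1 \<in> carrier ?R"
    by (auto simp: poly_ring_in_def)
  have neg: "- p \<in> K" if "p \<in> K" for p using mult[OF * that] by simp
  have inv: "\<ominus>\<^bsub>?R\<^esub> p = - p" if "p \<in> K" for p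
    using that neg[OF that] assms(1)
    by (intro R.minus_equality) (auto simp: poly_ring_in_def)
  show ?thesis
  proof (rule idealI)
    show "subgroup K (add_monoid ?R)"
      using assms neg inv
      by (intro R.add.subgroupI) (auto simp: poly_ring_in_def a_inv_def[symmetric])
    fix p q assume "p \<in> K" "q \<in> carrier ?R"
    then show "q \<otimes>\<^bsub>?R\<^esub> p \<in> K" "p \<otimes>\<^bsub>?R\<^esub> q \<in> K"
      using mult[of q p] by (auto simp: poly_ring_in_def mult.commute)
  qed (rule ring_poly_ring_in)
qed

lemma genideal_poly_ring_in_least:
  assumes "ideal K (poly_ring_in V)" "S \<subseteq> K"
  shows "genideal (poly_ring_in V) S \<subseteq> K"
  using assms by (auto simp: genideal_def)

text \<open>
  An ideal generated by monomials contains a monomial only if one of the generators divides it,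
  because the polynomials all of whose monomials are divisible by a generator form an ideal.
\<close>

lemma monomial_in_initial_idealD:
  fixes I :: "'k::field pring set"
  assumes "Poly_Mapping.single u 1 \<in> initial_ideal V I" "I \<subseteq> carrier (poly_ring_in V)"
  shows "\<exists>f \<in> I. f \<noteq> 0 \<and> (\<exists>w. u = lead_monom f + w)"
proof -
  let ?R = "poly_ring_in V :: 'k pring ring"
  define Q where "Q = (\<lambda>u. \<exists>f \<in> I. f \<noteq> 0 \<and> (\<exists>w. u = lead_monom f + w))"
  let ?K = "{p \<in> carrier ?R. \<forall>u \<in> Poly_Mapping.keys p. Q u}"
  interpret R: ring ?R by (rule ring_poly_ring_in)
  have "ideal ?K ?R"
  proof (rule ideal_poly_ring_inI)
    fix p q assume "p \<in> ?K" "q \<in> ?K"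
    then show "p + q \<in> ?K"
      using keys_add[of p q] R.a_closed[of p q] by (auto simp: poly_ring_in_def)
  next
    fix p q assume *: "p \<in> carrier ?R" "q \<in> ?K"
    have "Q u" if "u \<in> Poly_Mapping.keys (p * q)" for u
    proof -
      obtain v w where "u = v + w" "v \<in> Poly_Mapping.keys p" "w \<in> Poly_Mapping.keys q"
        using keys_mult[of p q] \<open>u \<in> _\<close> by blast
      moreover from this have "Q w" using * by auto
      ultimately show ?thesis unfolding Q_def by (metis add.left_commute)
    qed
    then show "p * q \<in> ?K" using * R.m_closed[of p q] by (auto simp: poly_ring_in_def)
  qed (auto simp: poly_ring_in_def)
  moreover have "{Poly_Mapping.single (lead_monom p) 1 | p. p \<in> I \<and> p \<noteq> 0} \<subseteq> ?K"
  proof -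
    have "Poly_Mapping.single (lead_monom p) 1 \<in> ?K" if "p \<in> I" "p \<noteq> 0" for p
    proof -
      have "lead_monom p \<in> Poly_Mapping.keys p"
        unfolding lead_monom_def using that by (intro Max_in) auto
      then have "Poly_Mapping.keys (lead_monom p) \<subseteq> V"
        using that assms(2) by (auto simp: poly_ring_in_def)
      moreover have "Q (lead_monom p)" unfolding Q_def using that by (metis add.right_neutral)
      ultimately show ?thesis by (auto simp: poly_ring_in_def)
    qed
    then show ?thesis by blast
  qed
  ultimately have "initial_ideal V I \<subseteq> ?K"
    unfolding initial_ideal_def by (rule genideal_poly_ring_in_least)
  then show ?thesis using assms(1) by (auto simp: Q_def)
qed

definition monom_eval :: "('v \<Rightarrow> 'a::comm_monoid_mult) \<Rightarrow> ('v \<Rightarrow>\<^sub>0 nat) \<Rightarrow> 'a" where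
  "monom_eval X u = (\<Prod>v \<in> Poly_Mapping.keys u. X v ^ Poly_Mapping.lookup u v)"

definition laurent_eval ::
    "(nat \<times> nat \<Rightarrow> expo \<Rightarrow>\<^sub>0 'k) \<Rightarrow> 'k::field pring \<Rightarrow> expo \<Rightarrow>\<^sub>0 'k" where
  "laurent_eval X p =
     (\<Sum>u \<in> Poly_Mapping.keys p. Poly_Mapping.single 0 (Poly_Mapping.lookup p u) * monom_eval X u)"

lemma monom_eval_superset:
  assumes "finite A" "Poly_Mapping.keys u \<subseteq> A"
  shows "monom_eval X u = (\<Prod>v \<in> A. X v ^ Poly_Mapping.lookup u v)"
  unfolding monom_eval_def using assms
  by (intro prod.mono_neutral_left) (auto simp: in_keys_iff)

lemma monom_eval_0 [simp]: "monom_eval X 0 = 1"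
  by (simp add: monom_eval_def)

lemma monom_eval_add: "monom_eval X (u + w) = monom_eval X u * monom_eval X w"
proof -
  let ?A = "Poly_Mapping.keys u \<union> Poly_Mapping.keys w"
  have "monom_eval X (u + w) = (\<Prod>v \<in> ?A. X v ^ Poly_Mapping.lookup (u + w) v)"
    using keys_add[of u w] by (intro monom_eval_superset) auto
  also have "\<dots> = (\<Prod>v \<in> ?A. X v ^ Poly_Mapping.lookup u v) * (\<Prod>v \<in> ?A. X v ^ Poly_Mapping.lookup w v)"
    by (simp add: lookup_add power_add prod.distrib)
  finally show ?thesis by (simp add: monom_eval_superset[of ?A])
qed

lemma laurent_eval_single [simp]:
  "laurent_eval X (Poly_Mapping.single u c) = Poly_Mapping.single 0 c * monom_eval X u"
  by (cases "c = 0") (auto simp: laurent_eval_def)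

lemma laurent_eval_0 [simp]: "laurent_eval X 0 = 0"
  by (simp add: laurent_eval_def)

lemma laurent_eval_add: "laurent_eval X (p + q) = laurent_eval X p + laurent_eval X q"
  unfolding laurent_eval_def
  by (rule setsum_keys_plus_distrib) (auto simp: single_add algebra_simps)

lemma laurent_eval_sum: "laurent_eval X (sum f A) = (\<Sum>a \<in> A. laurent_eval X (f a))"
  by (induction A rule: infinite_finite_induct) (auto simp: laurent_eval_add)

lemma poly_mapping_sum_singles:
  fixes p :: "'a \<Rightarrow>\<^sub>0 'b::comm_monoid_add"
  shows "(\<Sum>u \<in> Poly_Mapping.keys p. Poly_Mapping.single u (Poly_Mapping.lookup p u)) = p"
  by (rule poly_mapping_eqI) (auto simp: lookup_sum lookup_single when_def in_keys_iff)

lemma laurent_eval_mult: "laurent_eval X (p * q) = laurent_eval X p * laurent_eval X q"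
proof -
  have "p * q = (\<Sum>u \<in> Poly_Mapping.keys p. \<Sum>w \<in> Poly_Mapping.keys q.
      Poly_Mapping.single (u + w) (Poly_Mapping.lookup p u * Poly_Mapping.lookup q w))"
    by (subst (1 2) poly_mapping_sum_singles[symmetric])
      (simp only: sum_product mult_single)
  also have "laurent_eval X \<dots> = (\<Sum>u \<in> Poly_Mapping.keys p. \<Sum>w \<in> Poly_Mapping.keys q.
      (Poly_Mapping.single 0 (Poly_Mapping.lookup p u) * monom_eval X u) *
      (Poly_Mapping.single 0 (Poly_Mapping.lookup q w) * monom_eval X w))"
    unfolding laurent_eval_sum laurent_eval_single monom_eval_add
    by (intro sum.cong refl)
      (simp add: mult_single[of 0 _ 0, simplified, symmetric] mult_ac)
  finally show ?thesis unfolding laurent_eval_def sum_product .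
qed

lemma laurent_eval_hom: "comm_ring_hom (laurent_eval X)"
  by unfold_locales
    (simp_all add: laurent_eval_add laurent_eval_mult flip: single_one)

text \<open>
  The value \<open>c = 0\<close> is allowed: then all monomials of \<open>q\<close> are smaller than \<open>a\<close>. With this convention
  the relation is multiplicative.
\<close>

definition leads :: "expo \<Rightarrow> 'k::field \<Rightarrow> (expo \<Rightarrow>\<^sub>0 'k) \<Rightarrow> bool" where
  "leads a c q \<longleftrightarrow> (\<forall>w \<in> Poly_Mapping.keys (q - Poly_Mapping.single a c). w < a)"

lemma leads_mult:
  assumes "leads a c p" "leads b d q"
  shows "leads (a + b) (c * d) (p * q)"
proof -
  define p' where "p' = p - Poly_Mapping.single a c"
  define q' where "q' = q - Poly_Mapping.single b d"
  have p: "w < a" if "w \<in> Poly_Mapping.keys p'" for w using assms(1) that by (simp add: p'_def leads_def)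
  have q: "w < b" if "w \<in> Poly_Mapping.keys q'" for w using assms(2) that by (simp add: q'_def leads_def)
  have eq: "p * q - Poly_Mapping.single (a + b) (c * d) =
      p' * q' + (p' * Poly_Mapping.single b d + Poly_Mapping.single a c * q')"
    by (simp add: p'_def q'_def mult_single[symmetric] algebra_simps)
  show ?thesis
    unfolding leads_def
  proof
    fix w assume "w \<in> Poly_Mapping.keys (p * q - Poly_Mapping.single (a + b) (c * d))"
    then have "w \<in> Poly_Mapping.keys (p' * q') \<union> Poly_Mapping.keys (p' * Poly_Mapping.single b d) \<union>
        Poly_Mapping.keys (Poly_Mapping.single a c * q')"
      unfolding eq using keys_add by (metis (no_types, lifting) UnE UnI1 UnI2 subsetD)
    then show "w < a + b"
    proof (elim UnE)
      assume "w \<in> Poly_Mapping.keys (p' * q')"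
      then obtain u v where "w = u + v" "u \<in> Poly_Mapping.keys p'" "v \<in> Poly_Mapping.keys q'"
        using keys_mult[of p' q'] by blast
      then show ?thesis using p q add_strict_mono by blast
    next
      assume "w \<in> Poly_Mapping.keys (p' * Poly_Mapping.single b d)"
      then obtain u v where "w = u + v" "u \<in> Poly_Mapping.keys p'" "v \<in> Poly_Mapping.keys (Poly_Mapping.single b d)"
        using keys_mult[of p' "Poly_Mapping.single b d"] by blast
      then show ?thesis using p by (auto split: if_splits)
    next
      assume "w \<in> Poly_Mapping.keys (Poly_Mapping.single a c * q')"
      then obtain u v where "w = u + v" "u \<in> Poly_Mapping.keys (Poly_Mapping.single a c)" "v \<in> Poly_Mapping.keys q'"
        using keys_mult[of "Poly_Mapping.single a c" q'] by blast
      then show ?thesis using q by (auto split: if_splits)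
    qed
  qed
qed

lemma leads_1: "leads 0 1 1"
  by (simp add: leads_def flip: single_one)

lemma leads_lookup:
  assumes "leads a c q"
  shows "Poly_Mapping.lookup q a = c" and "a < b \<Longrightarrow> Poly_Mapping.lookup q b = 0"
proof -
  have "Poly_Mapping.lookup (q - Poly_Mapping.single a c) b = 0" if "a \<le> b" for b
    using assms that unfolding leads_def by (metis in_keys_iff not_less)
  from this[of a] this[of b]
  show "Poly_Mapping.lookup q a = c" "a < b \<Longrightarrow> Poly_Mapping.lookup q b = 0"
    by (auto simp: lookup_minus lookup_single when_def)
qed

definition int_expo :: "monom \<Rightarrow> expo" where
  "int_expo u = (\<Sum>v \<in> Poly_Mapping.keys u. Poly_Mapping.single v (int (Poly_Mapping.lookup u v)))"

lemma lookup_int_expo: "Poly_Mapping.lookup (int_expo u) v = int (Poly_Mapping.lookup u v)"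
  by (auto simp: int_expo_def lookup_sum lookup_single when_def in_keys_iff)

lemma int_expo_less_iff: "int_expo u < int_expo w \<longleftrightarrow> u < w"
  by (simp add: less_poly_mapping.rep_eq less_fun_def lookup_int_expo)

lemma leads_monom_eval:
  assumes "\<And>v. leads (Poly_Mapping.single v 1) (c v) (X v)"
  shows "leads (int_expo u) (\<Prod>v \<in> Poly_Mapping.keys u. c v ^ Poly_Mapping.lookup u v) (monom_eval X u)"
proof -
  have pow: "leads (Poly_Mapping.single v (int n)) (c v ^ n) (X v ^ n)" for v n
  proof (induction n)
    case (Suc n)
    then show ?case using leads_mult[OF assms[of v] Suc] by (simp flip: single_add)
  qed (simp add: leads_1)
  have "leads (\<Sum>v \<in> A. Poly_Mapping.single v (int (Poly_Mapping.lookup u v)))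
      (\<Prod>v \<in> A. c v ^ Poly_Mapping.lookup u v) (\<Prod>v \<in> A. X v ^ Poly_Mapping.lookup u v)"
    if "finite A" for A
    using that by (induction A) (auto simp: leads_1 intro!: leads_mult pow)
  then show ?thesis unfolding int_expo_def monom_eval_def by simp
qed

text \<open>
  If the substituted value \<open>X v\<close> has leading monomial \<open>v\<close> with coefficient \<open>1\<close> for \<open>v \<in> F\<close>, and only
  monomials smaller than \<open>v\<close> otherwise, then no monomial grows under the substitution, and those
  supported in \<open>F\<close> survive. So a leading term supported in \<open>F\<close> cannot cancel.
\<close>

lemma laurent_eval_ne_0:
  fixes f :: "'k::field pring"
  assumes X: "\<And>v. leads (Poly_Mapping.single v 1) (if v \<in> F then 1 else 0) (X v)"
    and f: "f \<noteq> 0" "Poly_Mapping.keys (lead_monom f) \<subseteq> F"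
  shows "laurent_eval X f \<noteq> 0"
proof
  assume 0: "laurent_eval X f = 0"
  let ?u = "lead_monom f"
  let ?c = "\<lambda>u. \<Prod>v \<in> Poly_Mapping.keys u. (if v \<in> F then 1 else 0 :: 'k) ^ Poly_Mapping.lookup u v"
  have L: "leads (int_expo u) (a * ?c u) (Poly_Mapping.single 0 a * monom_eval X u)" for u a
  proof -
    have "leads 0 a (Poly_Mapping.single 0 a)" by (simp add: leads_def)
    from leads_mult[OF this leads_monom_eval[of "\<lambda>v. if v \<in> F then 1 else 0", OF X]]
    show ?thesis by simp
  qed
  have u: "?u \<in> Poly_Mapping.keys f" unfolding lead_monom_def using f by (intro Max_in) auto
  have "Poly_Mapping.lookup (laurent_eval X f) (int_expo ?u) =
     (\<Sum>u \<in> Poly_Mapping.keys f. if u = ?u then Poly_Mapping.lookup f u else 0)"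
    unfolding laurent_eval_def lookup_sum
  proof (intro sum.cong refl)
    fix u assume uf: "u \<in> Poly_Mapping.keys f"
    show "Poly_Mapping.lookup (Poly_Mapping.single 0 (Poly_Mapping.lookup f u) * monom_eval X u) (int_expo ?u) =
       (if u = ?u then Poly_Mapping.lookup f u else 0)"
    proof (cases "u = ?u")
      case True
      have "?c ?u = 1" using f(2) by (intro prod.neutral) auto
      then show ?thesis using leads_lookup(1)[OF L[of ?u "Poly_Mapping.lookup f ?u"]] True by simp
    next
      case False
      have "u \<le> ?u" unfolding lead_monom_def using uf by simp
      then have "int_expo u < int_expo ?u" using False by (simp add: int_expo_less_iff)
      then show ?thesis using leads_lookup(2)[OF L] False by simp
    qed
  qed
  then show False using 0 u by (simp add: in_keys_iff)
qed

text \<open>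
  A sum of \<open>k\<close> rank-one matrices factors through \<open>k\<close> dimensions. Padding the factors to size \<open>r > k\<close> puts a
  zero row into the second one; in this form the argument works over any commutative ring.
\<close>

lemma det_low_rank:
  fixes f g :: "nat \<Rightarrow> nat \<Rightarrow> 'a::comm_ring_1"
  assumes "k < r"
  shows "det (mat r r (\<lambda>(a, b). \<Sum>l<k. f l a * g l b)) = 0"
proof -
  let ?A = "mat r r (\<lambda>(a, l). if l < k then f l a else 0)"
  let ?B = "mat r r (\<lambda>(l, b). if l < k then g l b else 0)"
  have "mat r r (\<lambda>(a, b). \<Sum>l<k. f l a * g l b) = ?A * ?B"
  proof (rule eq_matI)
    fix a b assume ab: "a < dim_row (?A * ?B)" "b < dim_col (?A * ?B)"
    have "(?A * ?B) $$ (a, b) = (\<Sum>l\<in>{0..<r}. (if l < k then f l a else 0) * (if l < k then g l b else 0))"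
      using ab by (simp add: scalar_prod_def)
    also have "\<dots> = (\<Sum>l<k. f l a * g l b)"
      using assms by (intro sum.mono_neutral_cong_right) auto
    finally show "mat r r (\<lambda>(a, b). \<Sum>l<k. f l a * g l b) $$ (a, b) = (?A * ?B) $$ (a, b)"
      using ab by simp
  qed auto
  moreover have "det (?A * ?B) = det ?A * det ?B" by (rule det_mult) auto
  moreover have "det ?B = 0" by (rule det_mat_zero_row[of k]) (use assms in auto)
  ultimately show ?thesis by simp
qed

section \<open>Squarefree monomials inside and outside the initial ideal\<close>

definition generic_matrix :: "nat \<Rightarrow> nat \<Rightarrow> (nat \<times> nat) set \<Rightarrow> 'k::field pring mat" where
  "generic_matrix n m V = mat n m (\<lambda>v. if v \<in> V then indet v else 0)"

lemma poly_ring_in_sum: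
  "(\<And>a. a \<in> A \<Longrightarrow> f a \<in> carrier (poly_ring_in V)) \<Longrightarrow> sum f A \<in> carrier (poly_ring_in V)"
proof (induction A rule: infinite_finite_induct)
  case (insert a A)
  then show ?case using ring.ring_simprules(1)[OF ring_poly_ring_in, of "f a" V "sum f A"]
    by (simp add: poly_ring_in_ops)
qed (auto simp: poly_ring_in_def)

lemma poly_ring_in_prod:
  "(\<And>a. a \<in> A \<Longrightarrow> f a \<in> carrier (poly_ring_in V)) \<Longrightarrow> prod f A \<in> carrier (poly_ring_in V)"
proof (induction A rule: infinite_finite_induct)
  case (insert a A)
  then show ?case using ring.ring_simprules(5)[OF ring_poly_ring_in, of "f a" V "prod f A"]
    by (simp add: poly_ring_in_ops)
qed (auto simp: poly_ring_in_def)

lemma minors_generic_matrixE: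
  fixes q :: "'k::field pring"
  assumes "q \<in> minors r (generic_matrix n m V)"
  obtains f g where "q = det (mat r r (\<lambda>(a, b). if (f a, g b) \<in> V then indet (f a, g b) else 0))"
proof -
  obtain I J where IJ: "I \<subseteq> {..<n}" "J \<subseteq> {..<m}" "card I = r" "card J = r"
    and q: "q = det (submatrix (generic_matrix n m V) I J)"
    using assms by (auto simp: minors_def generic_matrix_def)
  have "{i. i < n \<and> i \<in> I} = I" "{j. j < m \<and> j \<in> J} = J" using IJ by auto
  moreover have "pick I a < n" if "a < r" for a using pick_in_set_le[of a I] that IJ by auto
  moreover have "pick J a < m" if "a < r" for a using pick_in_set_le[of a J] that IJ by auto
  ultimately have "submatrix (generic_matrix n m V :: 'k pring mat) I J =
      mat r r (\<lambda>(a, b). if (pick I a, pick J b) \<in> V then indet (pick I a, pick J b) else 0)"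
    using IJ by (intro eq_matI) (auto simp: submatrix_def generic_matrix_def)
  then show thesis by (intro that[of "pick I" "pick J"]) (simp add: q)
qed

lemma pick_strict_mono:
  assumes "\<And>a b. a < b \<Longrightarrow> b < r \<Longrightarrow> f a < f b" "a < r"
  shows "pick (f ` {..<r}) a = f a"
proof -
  have less: "f b < f a \<longleftrightarrow> b < a" if "b < r" for b
    using assms that by (metis less_asym less_irrefl linorder_neqE_nat)
  have "{x \<in> f ` {..<r}. x < f a} = f ` {..<a}"
    using less assms(2) by (auto simp: image_iff)
  moreover have "inj_on f {..<a}"
    using assms by (intro linorder_inj_onI) (force simp: less_imp_neq)+
  ultimately have "card {x \<in> f ` {..<r}. x < f a} = a"
    by (simp add: card_image)
  then show ?thesis using pick_card_in_set[of "f a" "f ` {..<r}"] assms(2) by simp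
qed

lemma minor_of_chain:
  assumes f: "\<And>a b. a < b \<Longrightarrow> b < r \<Longrightarrow> f a < f b" "\<And>a. a < r \<Longrightarrow> f a < n"
    and g: "\<And>a b. a < b \<Longrightarrow> b < r \<Longrightarrow> g a < g b" "\<And>a. a < r \<Longrightarrow> g a < m"
  shows "det (mat r r (\<lambda>(a, b). if (f a, g b) \<in> V then indet (f a, g b) else 0)) \<in>
      minors r (generic_matrix n m V)"
proof -
  let ?I = "f ` {..<r}" and ?J = "g ` {..<r}"
  have card: "card ?I = r" "card ?J = r"
    using f(1) g(1) by (auto simp: card_image inj_on_def) (metis card_image card_lessThan inj_onI linorder_neqE_nat less_irrefl lessThan_iff)+
  have "?I \<subseteq> {..<n}" "?J \<subseteq> {..<m}" using f g by auto
  moreover from this have "{i. i < n \<and> i \<in> ?I} = ?I" "{j. j < m \<and> j \<in> ?J} = ?J" by auto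
  ultimately show ?thesis
    unfolding minors_def
    by (intro CollectI exI[of _ ?I] exI[of _ ?J] conjI arg_cong[where f = det] eq_matI)
      (auto simp: submatrix_def generic_matrix_def card pick_strict_mono f g)
qed

lemma minors_carrier: "minors r (generic_matrix n m V) \<subseteq> carrier (poly_ring_in V)"
proof
  fix q :: "'a pring" assume "q \<in> minors r (generic_matrix n m V)"
  then obtain f g where q: "q = det (mat r r (\<lambda>(a, b). if (f a, g b) \<in> V then indet (f a, g b) else 0))"
    by (rule minors_generic_matrixE)
  interpret R: ring "poly_ring_in V :: 'a pring ring" by (rule ring_poly_ring_in)
  have "(if v \<in> V then indet v else 0) \<in> carrier (poly_ring_in V :: 'a pring ring)" for v
    by (auto simp: poly_ring_in_def indet_def)
  then have prod: "(\<Prod>a = 0..<r. if (f a, g (p a)) \<in> V then indet (f a, g (p a)) else 0) \<in> carrier (poly_ring_in V :: 'a pring ring)" for p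
    by (intro poly_ring_in_prod)
  have "signof p \<in> carrier (poly_ring_in V :: 'a pring ring)" for p
    by (auto simp: poly_ring_in_def sign_def)
  with prod show "q \<in> carrier (poly_ring_in V)"
    unfolding q det_mat_Leibniz
    by (intro poly_ring_in_sum) (metis (no_types, lifting) R.m_closed poly_ring_in_ops(1))
qed

lemma minor_ideal_carrier: "minor_ideal V r (generic_matrix n m V) \<subseteq> carrier (poly_ring_in V)"
  unfolding minor_ideal_def
  by (rule genideal_poly_ring_in_least[OF ring.oneideal[OF ring_poly_ring_in] minors_carrier])

lemma prod_indet: "(\<Prod>v\<in>F. indet v) = Poly_Mapping.single (\<Sum>v\<in>F. Poly_Mapping.single v 1) 1"
  by (induction F rule: infinite_finite_induct) (auto simp: indet_def mult_single)

lemma keys_sum_singles: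
  "finite F \<Longrightarrow> Poly_Mapping.keys (\<Sum>v\<in>F. Poly_Mapping.single v (1::nat)) = F"
  by (auto simp: in_keys_iff lookup_sum lookup_single when_def split: if_splits)

text \<open>
  At the first row \<open>a\<close> that a permutation moves, it moves to the right, so the product of the permuted
  entries misses the entry \<open>(f a, g a)\<close> and agrees with the diagonal before it.
\<close>

lemma diagonal_monom_greatest:
  fixes r :: nat and f g :: "nat \<Rightarrow> nat"
  assumes f: "\<And>a b. a < b \<Longrightarrow> b < r \<Longrightarrow> f a < f b"
    and g: "\<And>a b. a < b \<Longrightarrow> b < r \<Longrightarrow> g a < g b"
    and p: "p permutes {0..<r}" "p \<noteq> id"
  shows "(\<Sum>a = 0..<r. Poly_Mapping.single (f a, g (p a)) 1 :: monom) <
      (\<Sum>a = 0..<r. Poly_Mapping.single (f a, g a) 1)"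
proof -
  define a where "a = (LEAST a. p a \<noteq> a)"
  have "\<exists>a. p a \<noteq> a" using p(2) by (metis eq_id_iff)
  then have ne: "p a \<noteq> a" unfolding a_def by (rule LeastI_ex[of "\<lambda>a. p a \<noteq> a"])
  have below: "p b = b" if "b < a" for b using not_less_Least[of b] that by (auto simp: a_def)
  have "a < r" using ne permutes_not_in[OF p(1), of a] by (meson atLeastLessThan_iff le0 not_le_imp_less)
  have pr: "p b < r" if "b < r" for b using permutes_in_image[OF p(1), of b] that by simp
  have "a < p a" using below ne permutes_inj[OF p(1)]
    by (metis injD linorder_neqE_nat)
  have f_eq: "f b = f c \<longleftrightarrow> b = c" if "b < r" "c < r" for b c
    using f that by (metis less_irrefl linorder_neqE_nat)
  have g_eq: "g b = g c \<longleftrightarrow> b = c" if "b < r" "c < r" for b c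
    using g that by (metis less_irrefl linorder_neqE_nat)
  show ?thesis
  proof (rule poly_mapping_lessI[of _ "(f a, g a)"])
    show "Poly_Mapping.lookup (\<Sum>a = 0..<r. Poly_Mapping.single (f a, g (p a)) 1 :: monom) (f a, g a) <
      Poly_Mapping.lookup (\<Sum>a = 0..<r. Poly_Mapping.single (f a, g a) 1) (f a, g a)"
    proof -
      have "Poly_Mapping.lookup (\<Sum>a = 0..<r. Poly_Mapping.single (f a, g (p a)) 1 :: monom) (f a, g a) = 0"
        using ne \<open>a < r\<close> pr by (auto simp: lookup_sum lookup_single when_def f_eq g_eq)
      moreover have "Poly_Mapping.lookup (\<Sum>a = 0..<r. Poly_Mapping.single (f a, g a) 1 :: monom) (f a, g a) = 1"
      proof -
        have "(\<Sum>b = 0..<r. Poly_Mapping.lookup (Poly_Mapping.single (f b, g b) 1 :: monom) (f a, g a)) =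
            (\<Sum>b = 0..<r. if b = a then 1 else 0)"
          using \<open>a < r\<close> by (intro sum.cong) (auto simp: lookup_single when_def f_eq)
        then show ?thesis using \<open>a < r\<close> by (simp add: lookup_sum)
      qed
      ultimately show ?thesis by simp
    qed
    fix v assume v: "v < (f a, g a)"
    show "Poly_Mapping.lookup (\<Sum>a = 0..<r. Poly_Mapping.single (f a, g (p a)) 1 :: monom) v =
      Poly_Mapping.lookup (\<Sum>a = 0..<r. Poly_Mapping.single (f a, g a) 1) v"
      unfolding lookup_sum
    proof (rule sum.cong)
      fix b assume b: "b \<in> {0..<r}"
      consider "b < a" | "b = a" | "a < b" by linarith
      then show "Poly_Mapping.lookup (Poly_Mapping.single (f b, g (p b)) 1 :: monom) v =
          Poly_Mapping.lookup (Poly_Mapping.single (f b, g b) 1) v"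
      proof cases
        case 2
        then show ?thesis
          using v g[OF \<open>a < p a\<close> pr[OF \<open>a < r\<close>]] by (auto simp: lookup_single when_def)
      next
        case 3
        then show ?thesis
          using v f[of a b] b by (auto simp: lookup_single when_def)
      qed (use below in auto)
    qed simp
  qed
qed

lemma lead_monom_minor:
  fixes V :: "(nat \<times> nat) set"
  assumes f: "\<And>a b. a < b \<Longrightarrow> b < r \<Longrightarrow> f a < f b"
    and g: "\<And>a b. a < b \<Longrightarrow> b < r \<Longrightarrow> g a < g b"
    and V: "\<And>a. a < r \<Longrightarrow> (f a, g a) \<in> V"
  defines "q \<equiv> det (mat r r (\<lambda>(a, b). if (f a, g b) \<in> V then indet (f a, g b) else 0 :: 'k::field pring))"
  shows "q \<noteq> 0" "lead_monom q = (\<Sum>a = 0..<r. Poly_Mapping.single (f a, g a) 1)"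
proof -
  define mon where "mon = (\<lambda>p. \<Sum>a = 0..<r. Poly_Mapping.single (f a, g (p a)) 1 :: monom)"
  define trm where "trm = (\<lambda>p. signof p * (\<Prod>a = 0..<r. if (f a, g (p a)) \<in> V then indet (f a, g (p a)) else 0 :: 'k pring))"
  have q: "q = (\<Sum>p | p permutes {0..<r}. trm p)"
    unfolding q_def det_mat_Leibniz trm_def by simp
  have prod_mon: "(\<Prod>a \<in> A. indet (f a, g (p a)) :: 'k pring) = Poly_Mapping.single (\<Sum>a \<in> A. Poly_Mapping.single (f a, g (p a)) 1) 1" for p A
    by (induction A rule: infinite_finite_induct) (auto simp: indet_def mult_single)
  have keys: "Poly_Mapping.keys (trm p) \<subseteq> {mon p}" for p
  proof (cases "\<forall>a < r. (f a, g (p a)) \<in> V")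
    case True
    then have "(\<Prod>a = 0..<r. if (f a, g (p a)) \<in> V then indet (f a, g (p a)) else 0 :: 'k pring) =
        Poly_Mapping.single (mon p) 1"
      unfolding mon_def prod_mon[symmetric] by (intro prod.cong) auto
    then show ?thesis by (auto simp: trm_def sign_def)
  next
    case False
    then have "(\<Prod>a = 0..<r. if (f a, g (p a)) \<in> V then indet (f a, g (p a)) else 0 :: 'k pring) = 0"
      by (intro prod_zero) auto
    then show ?thesis unfolding trm_def by (simp only: mult_zero_right keys_zero empty_subsetI)
  qed
  have less: "mon p < mon id" if "p permutes {0..<r}" "p \<noteq> id" for p
    unfolding mon_def using diagonal_monom_greatest[OF f g that] by simp
  have id: "trm id = Poly_Mapping.single (mon id) 1"
    unfolding trm_def mon_def prod_mon[symmetric] using V by (simp add: prod_mon[of id, simplified])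
  have "Poly_Mapping.lookup q (mon id) = (\<Sum>p | p permutes {0..<r}. if p = id then 1 else 0)"
    unfolding q lookup_sum
  proof (intro sum.cong refl)
    fix p assume p: "p \<in> {p. p permutes {0..<r}}"
    show "Poly_Mapping.lookup (trm p) (mon id) = (if p = id then 1 else 0)"
      using less[of p] keys[of p] p by (auto simp: id in_keys_iff)
  qed
  also have "\<dots> = 1" by (simp add: permutes_id finite_permutations)
  finally have 1: "Poly_Mapping.lookup q (mon id) = 1" .
  then show "q \<noteq> 0" by auto
  have "u \<le> mon id" if "u \<in> Poly_Mapping.keys q" for u
  proof -
    obtain p where "p permutes {0..<r}" "u \<in> Poly_Mapping.keys (trm p)"
      using \<open>u \<in> _\<close> keys_sum[of trm "{p. p permutes {0..<r}}"] unfolding q by blast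
    then show ?thesis using keys[of p] less[of p] by (cases "p = id") auto
  qed
  then show "lead_monom q = (\<Sum>a = 0..<r. Poly_Mapping.single (f a, g a) 1)"
    unfolding lead_monom_def using 1
    by (intro Max_eqI) (auto simp: mon_def in_keys_iff)
qed

text \<open>
  The product over the chain is the leading monomial of a minor, and it divides the product over \<open>F\<close>.
\<close>

lemma chain_in_initial_ideal:
  fixes V F :: "(nat \<times> nat) set"
  assumes V: "V \<subseteq> {..<n} \<times> {..<m}" "F \<subseteq> V"
    and f: "\<And>a b. a < b \<Longrightarrow> b < r \<Longrightarrow> f a < f b"
    and g: "\<And>a b. a < b \<Longrightarrow> b < r \<Longrightarrow> g a < g b"
    and F: "\<And>a. a < r \<Longrightarrow> (f a, g a) \<in> F"
  shows "(\<Prod>v\<in>F. indet v :: 'k::field pring) \<in> initial_ideal V (minor_ideal V r (generic_matrix n m V))"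
proof -
  let ?R = "poly_ring_in V :: 'k pring ring"
  interpret R: ring ?R by (rule ring_poly_ring_in)
  let ?I = "minor_ideal V r (generic_matrix n m V) :: 'k pring set"
  let ?S = "{Poly_Mapping.single (lead_monom p) 1 | p. p \<in> ?I \<and> p \<noteq> 0}"
  define q :: "'k pring" where "q = det (mat r r (\<lambda>(a, b). if (f a, g b) \<in> V then indet (f a, g b) else 0))"
  have fin: "finite F" using finite_subset[OF V(2) finite_subset[OF V(1)]] by simp
  have "q \<in> minors r (generic_matrix n m V)"
    unfolding q_def using f g F V by (intro minor_of_chain) blast+
  then have qI: "q \<in> ?I" unfolding minor_ideal_def using R.genideal_self[OF minors_carrier] by blast
  have FV: "(f a, g a) \<in> V" if "a < r" for a using F[OF that] V(2) by blast
  have q: "q \<noteq> 0" "lead_monom q = (\<Sum>a = 0..<r. Poly_Mapping.single (f a, g a) 1)"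
    unfolding q_def using FV by (simp_all add: lead_monom_minor f g)
  have inj: "inj_on (\<lambda>a. (f a, g a)) {0..<r}"
    using f by (intro linorder_inj_onI) (auto dest: less_imp_neq)
  define C where "C = (\<lambda>a. (f a, g a)) ` {0..<r}"
  have C: "C \<subseteq> F" using F by (auto simp: C_def)
  have leadC: "Poly_Mapping.single (lead_monom q) 1 = (\<Prod>v\<in>C. indet v :: 'k pring)"
    unfolding q(2) prod_indet C_def by (simp add: sum.reindex[OF inj])
  have S: "?S \<subseteq> carrier ?R"
  proof -
    have "lead_monom p \<in> Poly_Mapping.keys p" if "p \<noteq> 0" for p :: "'k pring"
      unfolding lead_monom_def using that by (intro Max_in) auto
    then show ?thesis using minor_ideal_carrier[of V r n m, where ?'a = 'k]
      by (fastforce simp: poly_ring_in_def)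
  qed
  interpret J: ideal "initial_ideal V ?I" ?R
    unfolding initial_ideal_def by (rule R.genideal_ideal[OF S])
  have "Poly_Mapping.single (lead_monom q) 1 \<in> initial_ideal V ?I"
    unfolding initial_ideal_def using R.genideal_self[OF S] qI q(1) by blast
  moreover have "(\<Prod>v\<in>F - C. indet v) \<in> carrier ?R"
    using V(2) by (intro poly_ring_in_prod) (auto simp: poly_ring_in_def indet_def)
  ultimately have "(\<Prod>v\<in>F - C. indet v) * (\<Prod>v\<in>C. indet v :: 'k pring) \<in> initial_ideal V ?I"
    using J.I_l_closed by (metis leadC poly_ring_in_ops(1))
  then show ?thesis using prod.subset_diff[OF C fin, of "indet :: _ \<Rightarrow> 'k pring"] by simp
qed

text \<open>
  The sum of the rank-one completions of the paths has rank less than \<open>r\<close> and vanishes outside \<open>V\<close>,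
  so substituting it annihilates the minors. On the other hand it satisfies the hypothesis of
  \<open>laurent_eval_ne_0\<close>: at an entry of \<open>F\<close> exactly one path contributes the indeterminate itself,
  because the paths are disjoint, and all other contributions are smaller.
\<close>

lemma path_union_not_in_initial_ideal:
  fixes V :: "(nat \<times> nat) set"
  assumes path: "\<And>l. l < k \<Longrightarrow> lattice_path (p l) (L l)"
    and box: "\<And>l. l < k \<Longrightarrow> {fst (p l (L l))..fst (p l 0)} \<times> {snd (p l 0)..snd (p l (L l))} \<subseteq> V"
    and disj: "\<And>l l'. l < k \<Longrightarrow> l' < k \<Longrightarrow> l \<noteq> l' \<Longrightarrow> p l ` {..L l} \<inter> p l' ` {..L l'} = {}"
    and "k < r"
  shows "(\<Prod>v \<in> (\<Union>l<k. p l ` {..L l}). indet v :: 'k::field pring) \<notin>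
    initial_ideal V (minor_ideal V r (generic_matrix n m V))"
proof
  let ?F = "\<Union>l<k. p l ` {..L l}"
  let ?I = "minor_ideal V r (generic_matrix n m V) :: 'k pring set"
  let ?R = "poly_ring_in V :: 'k pring ring"
  define rows where "rows = (\<lambda>l. {fst (p l (L l))..fst (p l 0)})"
  define cols where "cols = (\<lambda>l. {snd (p l 0)..snd (p l (L l))})"
  have "\<exists>\<alpha> \<beta> :: nat \<Rightarrow> expo. \<forall>i \<in> rows l. \<forall>j \<in> cols l.
       ((i, j) \<in> p l ` {..L l} \<longrightarrow> \<alpha> i + \<beta> j = Poly_Mapping.single (i, j) 1) \<and>
       ((i, j) \<notin> p l ` {..L l} \<longrightarrow> \<alpha> i + \<beta> j < Poly_Mapping.single (i, j) 1)" if "l < k" for l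
    using rank_one_completion[OF path[OF that]] unfolding rows_def cols_def by blast
  then obtain \<alpha> \<beta> :: "nat \<Rightarrow> nat \<Rightarrow> expo" where
    \<alpha>\<beta>: "\<And>l i j. \<lbrakk>l < k; i \<in> rows l; j \<in> cols l\<rbrakk> \<Longrightarrow>
       ((i, j) \<in> p l ` {..L l} \<longrightarrow> \<alpha> l i + \<beta> l j = Poly_Mapping.single (i, j) 1) \<and>
       ((i, j) \<notin> p l ` {..L l} \<longrightarrow> \<alpha> l i + \<beta> l j < Poly_Mapping.single (i, j) 1)"
    by metis
  define f where "f = (\<lambda>l i. if i \<in> rows l then Poly_Mapping.single (\<alpha> l i) (1 :: 'k) else 0)"
  define g where "g = (\<lambda>l j. if j \<in> cols l then Poly_Mapping.single (\<beta> l j) (1 :: 'k) else 0)"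
  define X where "X = (\<lambda>v. \<Sum>l<k. f l (fst v) * g l (snd v))"
  have fg: "f l i * g l j = (if i \<in> rows l \<and> j \<in> cols l then Poly_Mapping.single (\<alpha> l i + \<beta> l j) 1 else 0)" for l i j
    by (simp add: f_def g_def mult_single)
  have on: "f l i * g l j = Poly_Mapping.single (Poly_Mapping.single (i, j) 1) 1"
    if l: "l < k" "(i, j) \<in> p l ` {..L l}" for l i j
  proof -
    obtain t where t: "t \<le> L l" "(i, j) = p l t" using l(2) by blast
    have "i \<in> rows l" "j \<in> cols l"
      using lattice_path_mono[OF path[OF l(1)], of 0 t] lattice_path_mono[OF path[OF l(1)], of t "L l"] t(1)
      by (auto simp: rows_def cols_def simp flip: t(2))
    then show ?thesis using \<alpha>\<beta>[of l i j] l by (simp add: fg)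
  qed
  have off: "w < Poly_Mapping.single (i, j) 1"
    if "l < k" "(i, j) \<notin> p l ` {..L l}" "w \<in> Poly_Mapping.keys (f l i * g l j)" for l i j w
    using that \<alpha>\<beta>[of l i j] by (auto simp: fg split: if_splits)
  have leads: "leads (Poly_Mapping.single v 1) (if v \<in> ?F then 1 else 0) (X v)" for v
  proof -
    obtain i j where v: "v = (i, j)" by (cases v)
    define A where "A = {l \<in> {..<k}. (i, j) \<notin> p l ` {..L l}}"
    have "X v - Poly_Mapping.single (Poly_Mapping.single v 1) (if v \<in> ?F then 1 else 0) = (\<Sum>l \<in> A. f l i * g l j)"
    proof (cases "v \<in> ?F")
      case True
      then obtain l0 where l0: "l0 < k" "(i, j) \<in> p l0 ` {..L l0}" by (auto simp: v)
      then have A: "A = {..<k} - {l0}" using disj[of l0] by (fastforce simp: A_def)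
      have "X v = f l0 i * g l0 j + (\<Sum>l \<in> A. f l i * g l j)"
        unfolding X_def v A fst_conv snd_conv using l0(1) by (intro sum.remove) auto
      then show ?thesis using True on[OF l0] by (simp add: v)
    next
      case False
      then have "A = {..<k}" by (auto simp: A_def v)
      then show ?thesis using False by (simp add: X_def v)
    qed
    moreover have "w < Poly_Mapping.single v 1" if "w \<in> Poly_Mapping.keys (\<Sum>l \<in> A. f l i * g l j)" for w
    proof -
      obtain l where "l \<in> A" "w \<in> Poly_Mapping.keys (f l i * g l j)"
        using \<open>w \<in> _\<close> keys_sum[of "\<lambda>l. f l i * g l j" A] by blast
      then show ?thesis using off by (auto simp: A_def v)
    qed
    ultimately show ?thesis unfolding leads_def by simp
  qed
  have supp: "X v = 0" if "v \<notin> V" for v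
  proof -
    have "f l (fst v) * g l (snd v) = 0" if "l < k" for l
      using subsetD[OF box[OF that], of v] \<open>v \<notin> V\<close> by (auto simp: fg rows_def cols_def mem_Times_iff)
    then show ?thesis unfolding X_def by (intro sum.neutral) simp
  qed
  interpret ev: comm_ring_hom "laurent_eval X" by (rule laurent_eval_hom)
  have entry: "laurent_eval X (if v \<in> V then indet v else 0) = X v" for v
    using supp[of v] by (auto simp: indet_def monom_eval_def)
  have ev0: "laurent_eval X q = 0" if q: "q \<in> ?I" for q
  proof -
    let ?K = "{q \<in> carrier ?R. laurent_eval X q = 0}"
    interpret R: ring ?R by (rule ring_poly_ring_in)
    have "ideal ?K ?R"
    proof (rule ideal_poly_ring_inI)
      show "0 \<in> ?K" by (simp add: poly_ring_in_def)
      show "a + b \<in> ?K" if "a \<in> ?K" "b \<in> ?K" for a b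
        using that R.a_closed[of a b] by (simp add: laurent_eval_add poly_ring_in_ops)
      show "a * b \<in> ?K" if "a \<in> carrier ?R" "b \<in> ?K" for a b
        using that R.m_closed[of a b] by (simp add: laurent_eval_mult poly_ring_in_ops)
    qed simp
    moreover have "minors r (generic_matrix n m V) \<subseteq> ?K"
    proof
      fix q :: "'k pring" assume q: "q \<in> minors r (generic_matrix n m V)"
      then obtain a b where qe: "q = det (mat r r (\<lambda>(c, d). if (a c, b d) \<in> V then indet (a c, b d) else 0))"
        by (rule minors_generic_matrixE)
      have "laurent_eval X q = det (mat r r (\<lambda>(c, d). X (a c, b d)))"
        unfolding qe ev.hom_det[symmetric]
        by (intro arg_cong[where f = det] eq_matI) (auto simp: entry)
      also have "\<dots> = 0"
        unfolding X_def fst_conv snd_conv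
        using det_low_rank[OF \<open>k < r\<close>, of "\<lambda>l c. f l (a c)" "\<lambda>l d. g l (b d)"] by simp
      finally show "q \<in> ?K" using q minors_carrier by blast
    qed
    ultimately have "?I \<subseteq> ?K" unfolding minor_ideal_def by (rule genideal_poly_ring_in_least)
    then show ?thesis using q by blast
  qed
  assume "(\<Prod>v \<in> ?F. indet v :: 'k pring) \<in> initial_ideal V ?I"
  then obtain q w where q: "q \<in> ?I" "q \<noteq> 0" "(\<Sum>v\<in>?F. Poly_Mapping.single v 1) = lead_monom q + w"
    unfolding prod_indet using monomial_in_initial_idealD[OF _ minor_ideal_carrier] by blast
  have "Poly_Mapping.keys (lead_monom q) \<subseteq> Poly_Mapping.keys (lead_monom q + w)"
    by (auto simp: in_keys_iff lookup_add)
  also have "\<dots> = ?F" unfolding q(3)[symmetric] by (intro keys_sum_singles) auto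
  finally have "laurent_eval X q \<noteq> 0" using laurent_eval_ne_0[OF leads q(2)] by blast
  then show False using ev0 q(1) by blast
qed

section \<open>Chain-free sets of maximal size\<close>

text \<open>
  Equivalently, \<open>F\<close> contains the main diagonal of an \<open>r \<times> r\<close> submatrix.
\<close>

definition has_chain :: "nat \<Rightarrow> (nat \<times> nat) set \<Rightarrow> bool" where
  "has_chain r F \<longleftrightarrow> (\<exists>f g. (\<forall>a b. a < b \<and> b < r \<longrightarrow> f a < f b \<and> g a < g b) \<and> (\<forall>a<r. (f a, g a) \<in> F))"

lemma has_chainI:
  assumes "\<And>a b. a < b \<Longrightarrow> b < r \<Longrightarrow> f a < f b" "\<And>a b. a < b \<Longrightarrow> b < r \<Longrightarrow> g a < g b"
    and "\<And>a. a < r \<Longrightarrow> (f a, g a) \<in> F"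
  shows "has_chain r F"
  using assms unfolding has_chain_def by blast

text \<open>
  Two chains of length \<open>k\<close>, with columns \<open>x\<close> and \<open>y\<close>, lie on two diagonals. If the \<open>i\<close>-th point of the first
  is strictly above and to the left of the \<open>i\<close>-th point of the second, then the first chain up to that
  point, followed by the second chain from its \<open>i\<close>-th point on, has one more element.
\<close>

lemma has_chain_of_two_diagonals:
  fixes x y :: "nat \<Rightarrow> nat"
  assumes x: "\<And>a b. a < b \<Longrightarrow> b < k \<Longrightarrow> x a < x b" "\<And>a. a < k \<Longrightarrow> c \<le> n + x a \<and> (n + x a - c, x a) \<in> F"
    and y: "\<And>a b. a < b \<Longrightarrow> b < k \<Longrightarrow> y a < y b" "\<And>a. a < k \<Longrightarrow> d \<le> n + y a \<and> (n + y a - d, y a) \<in> F"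
    and i: "i < k" "x i < y i" "n + x i - c < n + y i - d"
  shows "has_chain (Suc k) F"
proof -
  define f where "f = (\<lambda>a. if a \<le> i then n + x a - c else n + y (a - 1) - d)"
  define g where "g = (\<lambda>a. if a \<le> i then x a else y (a - 1))"
  have "f a < f b \<and> g a < g b" if "a < b" "b < Suc k" for a b
  proof -
    consider "b \<le> i" | "a \<le> i" "i < b" | "i < a" by linarith
    then show ?thesis
    proof cases
      case 1
      then have "x a < x b" "c \<le> n + x a" using x that i by auto
      then show ?thesis using 1 that by (auto simp: f_def g_def)
    next
      case 2
      have "x a \<le> x i" using x(1)[of a i] 2 i by (cases "a = i") auto
      have "i < b - 1 \<or> i = b - 1" using 2 by linarith
      moreover have "b - 1 < k" using 2 that by linarith
      ultimately have "y i \<le> y (b - 1)" using y(1)[of i "b - 1"] by auto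
      with \<open>x a \<le> x i\<close> show ?thesis using 2 i x(2)[of a] by (auto simp: f_def g_def)
    next
      case 3
      have "y (a - 1) < y (b - 1)" "d \<le> n + y (a - 1)"
        using y(1)[of "a - 1" "b - 1"] y(2)[of "a - 1"] 3 that by auto
      then show ?thesis using 3 that by (auto simp: f_def g_def)
    qed
  qed
  moreover have "(f a, g a) \<in> F" if "a < Suc k" for a
    using x(2)[of a] y(2)[of "a - 1"] that i(1) by (auto simp: f_def g_def)
  ultimately show ?thesis unfolding has_chain_def by blast
qed

text \<open>
  The entry \<open>(i, j)\<close> lies on the diagonal with index \<open>n + j - i\<close>, a positive number; the bottom left corner
  has index \<open>1\<close> and the top right corner \<open>n + m - 1\<close>. The numbers \<open>\<tau>1\<close> and \<open>\<tau>2\<close> are \<open>T\<^sub>1\<close> and \<open>T\<^sub>2\<close>. Cutting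
  off triangles of these sizes leaves \<open>N + 1\<close> diagonals with at least \<open>r - 1\<close> entries each. The
  entries of \<open>V\<close> that are cut off are \<open>corners\<close>: they exist only at a corner with \<open>t < r - 2\<close>, and are too
  close to it to lie in a chain of length \<open>r\<close>, so that every face of maximal dimension contains them.
\<close>

locale triangle_shape =
  fixes n m r t1 t2 :: nat
  assumes r: "1 \<le> r" "r \<le> n" "r \<le> m"
    and t: "t1 < n" "t1 < m" "t2 < n" "t2 < m"
begin

definition "V = {(i, j). i < n \<and> j < m \<and> i + t1 < n + j \<and> j + t2 < m + i}"

definition "k = r - 1"
definition "\<tau>1 = max (r - 2) t1"
definition "\<tau>2 = max (r - 2) t2"
definition "N = n + m - 2 - \<tau>1 - \<tau>2"

definition "diag s = {(i, j) \<in> V. n + j = i + \<tau>1 + 1 + s}"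

definition "corners = V - (\<Union>s\<le>N. diag s)"

lemma bounds: "\<tau>1 < n" "\<tau>1 < m" "\<tau>2 < n" "\<tau>2 < m" "N + \<tau>1 + \<tau>2 + 2 = n + m" "t1 \<le> \<tau>1" "t2 \<le> \<tau>2" "r = Suc k"
    "k \<le> \<tau>1 + 1" "k \<le> \<tau>2 + 1"
  using r t by (auto simp: \<tau>1_def \<tau>2_def N_def k_def)

lemma short: "t1 < \<tau>1 \<Longrightarrow> \<tau>1 + 1 = k" "t2 < \<tau>2 \<Longrightarrow> \<tau>2 + 1 = k"
  using r t by (auto simp: \<tau>1_def \<tau>2_def k_def max_def split: if_splits)

lemma finite_V: "finite V"
  by (rule finite_subset[of _ "{..<n} \<times> {..<m}"]) (auto simp: V_def)

lemma finite_diag: "finite (diag s)"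
  by (rule finite_subset[OF _ finite_V]) (auto simp: diag_def)

lemma diag_disjoint: "s \<noteq> s' \<Longrightarrow> diag s \<inter> diag s' = {}"
  by (auto simp: diag_def)

lemma corners_iff: "(i, j) \<in> corners \<longleftrightarrow> (i, j) \<in> V \<and> (n + j \<le> i + \<tau>1 \<or> m + i \<le> j + \<tau>2)"
proof -
  have "(\<exists>s\<le>N. n + j = i + \<tau>1 + 1 + s) \<longleftrightarrow> \<not> (n + j \<le> i + \<tau>1 \<or> m + i \<le> j + \<tau>2)"
  proof (intro iffI notI)
    assume *: "\<not> (n + j \<le> i + \<tau>1 \<or> m + i \<le> j + \<tau>2)"
    show "\<exists>s\<le>N. n + j = i + \<tau>1 + 1 + s"
      using * bounds(5) by (intro exI[of _ "n + j - i - \<tau>1 - 1"]) auto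
  qed (use bounds(5) in auto)
  then show ?thesis by (auto simp: corners_def diag_def)
qed

lemma card_face:
  assumes "F \<subseteq> V"
  shows "card F = card (F \<inter> corners) + (\<Sum>s\<le>N. card (F \<inter> diag s))"
proof -
  have fin: "finite F" using assms finite_V finite_subset by blast
  have "F = (F \<inter> corners) \<union> (\<Union>s\<le>N. F \<inter> diag s)" using assms by (auto simp: corners_def)
  then have 1: "card F = card ((F \<inter> corners) \<union> (\<Union>s\<le>N. F \<inter> diag s))" by (rule arg_cong)
  have 2: "card ((F \<inter> corners) \<union> (\<Union>s\<le>N. F \<inter> diag s)) = card (F \<inter> corners) + card (\<Union>s\<le>N. F \<inter> diag s)"
    using fin by (intro card_Un_disjoint) (auto simp: corners_def)
  have 3: "card (\<Union>s\<le>N. F \<inter> diag s) = (\<Sum>s\<le>N. card (F \<inter> diag s))"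
    using fin diag_disjoint by (intro card_UN_disjoint) fastforce+
  show ?thesis unfolding 1 2 3 ..
qed

definition "diag_cols F s = sorted_list_of_set (snd ` (F \<inter> diag s))"

lemma diag_cols_facts:
  "sorted_wrt (<) (diag_cols F s)" "length (diag_cols F s) = card (F \<inter> diag s)"
  "a < length (diag_cols F s) \<Longrightarrow> \<tau>1 + 1 + s \<le> n + diag_cols F s ! a \<and> (n + diag_cols F s ! a - (\<tau>1 + 1 + s), diag_cols F s ! a) \<in> F \<inter> diag s"
proof -
  have inj: "inj_on snd (F \<inter> diag s)" by (auto simp: inj_on_def diag_def)
  have fin: "finite (F \<inter> diag s)" using finite_diag by blast
  show "sorted_wrt (<) (diag_cols F s)" by (simp add: diag_cols_def)
  show "length (diag_cols F s) = card (F \<inter> diag s)" by (simp add: diag_cols_def card_image[OF inj])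
  assume "a < length (diag_cols F s)"
  then have "diag_cols F s ! a \<in> snd ` (F \<inter> diag s)"
    using nth_mem[of a "diag_cols F s"] fin by (simp add: diag_cols_def)
  then obtain i where "(i, diag_cols F s ! a) \<in> F \<inter> diag s" by auto
  moreover from this have "n + diag_cols F s ! a = i + \<tau>1 + 1 + s" by (auto simp: diag_def)
  ultimately show "\<tau>1 + 1 + s \<le> n + diag_cols F s ! a \<and> (n + diag_cols F s ! a - (\<tau>1 + 1 + s), diag_cols F s ! a) \<in> F \<inter> diag s"
    by simp
qed

lemma diag_cols_less: "a < b \<Longrightarrow> b < card (F \<inter> diag s) \<Longrightarrow> diag_cols F s ! a < diag_cols F s ! b"
  using diag_cols_facts(1,2)[of F s] by (simp add: sorted_wrt_iff_nth_less)

text \<open>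
  A diagonal is itself a chain.
\<close>

lemma card_diag_le:
  assumes "\<not> has_chain r F"
  shows "card (F \<inter> diag s) \<le> k"
proof (rule ccontr)
  assume "\<not> card (F \<inter> diag s) \<le> k"
  then have len: "a < length (diag_cols F s)" if "a < r" for a
    using that bounds(8) by (simp add: diag_cols_facts(2))
  define x where "x = (\<lambda>a. diag_cols F s ! a)"
  have x: "\<tau>1 + 1 + s \<le> n + x a" "(n + x a - (\<tau>1 + 1 + s), x a) \<in> F" if "a < r" for a
    using diag_cols_facts(3)[OF len[OF that]] by (simp_all add: x_def)
  have less: "x a < x b" if "a < b" "b < r" for a b
    using diag_cols_less[OF that(1)] len[OF that(2)] by (simp add: x_def diag_cols_facts(2))
  have "has_chain r F"
  proof (rule has_chainI)
    show "n + x a - (\<tau>1 + 1 + s) < n + x b - (\<tau>1 + 1 + s)" if "a < b" "b < r" for a b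
      using less[OF that] x(1)[of a] that by linarith
    show "x a < x b" if "a < b" "b < r" for a b by (rule less[OF that])
    show "(n + x a - (\<tau>1 + 1 + s), x a) \<in> F" if "a < r" for a by (rule x(2)[OF that])
  qed
  with assms show False by blast
qed

definition "top_card = card corners + Suc N * k"

lemma card_face_le:
  assumes "F \<subseteq> V" "\<not> has_chain r F"
  shows "card F \<le> top_card"
proof -
  have "card (F \<inter> corners) \<le> card corners"
    using finite_V by (intro card_mono) (auto simp: corners_def)
  moreover have "(\<Sum>s\<le>N. card (F \<inter> diag s)) \<le> (\<Sum>s\<le>N. k)"
    using card_diag_le[OF assms(2)] by (intro sum_mono) auto
  ultimately show ?thesis unfolding card_face[OF assms(1)] top_card_def by simp
qed

lemma card_face_eqD:
  assumes "F \<subseteq> V" "\<not> has_chain r F" "card F = top_card"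
  shows "corners \<subseteq> F" "\<And>s. s \<le> N \<Longrightarrow> card (F \<inter> diag s) = k"
proof -
  have fin: "finite corners" using finite_V by (auto simp: corners_def)
  have 1: "card (F \<inter> corners) \<le> card corners" using fin by (intro card_mono) auto
  have 2: "(\<Sum>s\<le>N. card (F \<inter> diag s)) \<le> (\<Sum>s\<le>N. k)"
    using card_diag_le[OF assms(2)] by (intro sum_mono) auto
  have sum: "card (F \<inter> corners) + (\<Sum>s\<le>N. card (F \<inter> diag s)) = card corners + (\<Sum>s\<le>N. k)"
    using card_face[OF assms(1)] assms(3) by (simp add: top_card_def)
  then have "card (F \<inter> corners) = card corners" using 1 2 by linarith
  then have "F \<inter> corners = corners" using fin by (intro card_subset_eq) auto
  then show "corners \<subseteq> F" by blast
  fix s assume s: "s \<le> N"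
  show "card (F \<inter> diag s) = k"
  proof (rule ccontr)
    assume "card (F \<inter> diag s) \<noteq> k"
    then have "card (F \<inter> diag s) < k" using card_diag_le[OF assms(2), of s] by simp
    then have "(\<Sum>s\<le>N. card (F \<inter> diag s)) < (\<Sum>s\<le>N. k)"
      using card_diag_le[OF assms(2)] s by (intro sum_strict_mono_ex1) auto
    then show False using sum 1 by linarith
  qed
qed

text \<open>
  In a chain-free set with \<open>k\<close> entries on each of two neighbouring diagonals, the \<open>i\<close>-th entries are
  neighbours in the matrix: otherwise one of them is strictly above and to the left of the other, and
  \<open>has_chain_of_two_diagonals\<close> gives a chain that is too long. Thus the set is a union of lattice paths.
\<close>

lemma diag_cols_step:
  assumes F: "\<not> has_chain r F" and s: "card (F \<inter> diag s) = k" "card (F \<inter> diag (Suc s)) = k" and i: "i < k"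
  shows "diag_cols F (Suc s) ! i = diag_cols F s ! i \<or> diag_cols F (Suc s) ! i = Suc (diag_cols F s ! i)"
proof (rule ccontr)
  assume *: "\<not> ?thesis"
  have 1: "\<tau>1 + 1 + s \<le> n + diag_cols F s ! a \<and> (n + diag_cols F s ! a - (\<tau>1 + 1 + s), diag_cols F s ! a) \<in> F" if "a < k" for a
    using diag_cols_facts(3)[of a F s] that s(1) by (simp add: diag_cols_facts(2))
  have 2: "\<tau>1 + 1 + Suc s \<le> n + diag_cols F (Suc s) ! a \<and> (n + diag_cols F (Suc s) ! a - (\<tau>1 + 1 + Suc s), diag_cols F (Suc s) ! a) \<in> F" if "a < k" for a
    using diag_cols_facts(3)[of a F "Suc s"] that s(2) by (simp add: diag_cols_facts(2))
  have less: "diag_cols F s ! a < diag_cols F s ! b" "diag_cols F (Suc s) ! a < diag_cols F (Suc s) ! b" if "a < b" "b < k" for a b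
    using that s by (auto intro: diag_cols_less)
  have "diag_cols F (Suc s) ! i < diag_cols F s ! i \<or> Suc (diag_cols F s ! i) < diag_cols F (Suc s) ! i" using * by linarith
  then have "has_chain (Suc k) F"
  proof
    assume *: "diag_cols F (Suc s) ! i < diag_cols F s ! i"
    then have "n + diag_cols F (Suc s) ! i - (\<tau>1 + 1 + Suc s) < n + diag_cols F s ! i - (\<tau>1 + 1 + s)"
      using 1[OF i] 2[OF i] by linarith
    from has_chain_of_two_diagonals[where x = "(!) (diag_cols F (Suc s))" and y = "(!) (diag_cols F s)",
        OF less(2) 2 less(1) 1 i * this] show ?thesis .
  next
    assume *: "Suc (diag_cols F s ! i) < diag_cols F (Suc s) ! i"
    then have "n + diag_cols F s ! i - (\<tau>1 + 1 + s) < n + diag_cols F (Suc s) ! i - (\<tau>1 + 1 + Suc s)"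
      using 1[OF i] 2[OF i] by linarith
    from has_chain_of_two_diagonals[where x = "(!) (diag_cols F s)" and y = "(!) (diag_cols F (Suc s))",
        OF less(1) 1 less(2) 2 i Suc_lessD[OF *] this] show ?thesis .
  qed
  then show False using F bounds(8) by simp
qed

section \<open>Encoding by particle systems\<close>

text \<open>
  A face of maximal dimension is recorded by its columns on the \<open>N + 1\<close> diagonals. In these lists
  columns are counted from \<open>1\<close>, so that the columns on the first diagonal are the numbers \<open>a\<^sub>i\<close>, and
  those on the last one the numbers \<open>b\<^sub>j\<close> shifted by \<open>m - 1 - T\<^sub>2\<close>.
\<close>

abbreviation "starts \<equiv> increasing_seqs k (int \<tau>1 + 1)"
abbreviation "ends \<equiv> increasing_seqs k (int \<tau>2 + 1)"
abbreviation "shift b \<equiv> map ((+) (int m - 1 - int \<tau>2)) b"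

definition "tracks = (\<Union>(a, b) \<in> starts \<times> ends. walks N a (shift b))"

definition "face_of ws = corners \<union> {(i, j). \<exists>s\<le>N. n + j = i + \<tau>1 + 1 + s \<and> int j + 1 \<in> set (ws ! s)}"

definition "track_of F = map (\<lambda>s. map (\<lambda>j. int j + 1) (diag_cols F s)) [0..<Suc N]"

text \<open>
  The bounds on the columns say that the tracks stay inside the matrix. They follow from the bounds at
  the two ends, since a column never decreases and grows by at most one per step.
\<close>

lemma tracksD:
  assumes "ws \<in> tracks"
  shows "length ws = Suc N"
    and "s \<le> N \<Longrightarrow> length (ws ! s) = k" "s \<le> N \<Longrightarrow> sorted_wrt (<) (ws ! s)"
    and "s < N \<Longrightarrow> l < k \<Longrightarrow> ws ! Suc s ! l - ws ! s ! l \<in> {0, 1}"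
    and "s \<le> N \<Longrightarrow> l < k \<Longrightarrow> 1 \<le> ws ! s ! l \<and> ws ! s ! l \<le> int \<tau>1 + 1 + int s"
    and "s \<le> N \<Longrightarrow> l < k \<Longrightarrow> int \<tau>1 + 2 + int s \<le> int n + ws ! s ! l \<and> ws ! s ! l \<le> int m"
    and "l < k \<Longrightarrow> t1 < \<tau>1 \<Longrightarrow> ws ! 0 ! l = int l + 1"
    and "l < k \<Longrightarrow> t2 < \<tau>2 \<Longrightarrow> ws ! N ! l = int m - int \<tau>2 + int l"
proof -
  obtain a b where ab: "a \<in> starts" "b \<in> ends" "ws \<in> walks N a (shift b)"
    using assms by (auto simp: tracks_def)
  have seq: "length c = k" "sorted_wrt (<) c" "\<And>l. l < k \<Longrightarrow> c ! l \<in> {1..M}" if "c \<in> increasing_seqs k M" for c M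
    using that nth_mem[of _ c] by (auto simp: increasing_seqs_def subset_iff)
  note a = seq[OF ab(1)] and b = seq(1,3)[OF ab(2)]
  have ws: "length ws = Suc N" "ws ! 0 = a" "ws ! N = shift b" "\<forall>s<N. one_step (ws ! s) (ws ! Suc s)"
    using ab(3) by (auto simp: walks_iff)
  show "length ws = Suc N" by (rule ws)
  have len_sort: "length (ws ! s) = k \<and> sorted_wrt (<) (ws ! s)" if "s \<le> N" for s
    using that
  proof (induction s)
    case (Suc s)
    then show ?case using ws(4) by (auto simp: one_step_def)
  qed (use ws a in auto)
  then show "s \<le> N \<Longrightarrow> length (ws ! s) = k" "s \<le> N \<Longrightarrow> sorted_wrt (<) (ws ! s)" by auto
  have mv: "ws ! Suc s ! l - ws ! s ! l \<in> {0, 1}" if "s < N" "l < k" for s l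
    using ws(4) len_sort[of s] that by (auto simp: one_step_def)
  then show "s < N \<Longrightarrow> l < k \<Longrightarrow> ws ! Suc s ! l - ws ! s ! l \<in> {0, 1}" .
  have up: "1 \<le> ws ! s ! l \<and> ws ! s ! l \<le> int \<tau>1 + 1 + int s" if "s \<le> N" "l < k" for s l
    using that
  proof (induction s)
    case 0
    then show ?case using a ws by auto
  next
    case (Suc s)
    then show ?case using mv[of s l] by auto
  qed
  then show "s \<le> N \<Longrightarrow> l < k \<Longrightarrow> 1 \<le> ws ! s ! l \<and> ws ! s ! l \<le> int \<tau>1 + 1 + int s" .
  have "int \<tau>1 + 2 + int s \<le> int n + ws ! s ! l \<and> ws ! s ! l \<le> int m" if "s \<le> N" "l < k" for s l
    using that
  proof (induction s rule: inc_induct)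
    case base
    have "ws ! N ! l = int m - 1 - int \<tau>2 + b ! l" using ws(3) b \<open>l < k\<close> by simp
    then show ?case using b(2)[OF \<open>l < k\<close>] bounds(5) by auto
  next
    case (step s)
    then show ?case using mv[OF step(2) \<open>l < k\<close>] by auto
  qed
  then show "s \<le> N \<Longrightarrow> l < k \<Longrightarrow> int \<tau>1 + 2 + int s \<le> int n + ws ! s ! l \<and> ws ! s ! l \<le> int m" .
  show "ws ! 0 ! l = int l + 1" if "l < k" "t1 < \<tau>1"
  proof -
    have "int \<tau>1 + 1 = int k" using short(1)[OF that(2)] by simp
    then show ?thesis using increasing_seqs_full[of a k l] ab(1) that(1) ws(2) by simp
  qed
  show "ws ! N ! l = int m - int \<tau>2 + int l" if "l < k" "t2 < \<tau>2"
  proof -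
    have "int \<tau>2 + 1 = int k" using short(2)[OF that(2)] by simp
    then show ?thesis using increasing_seqs_full[of b k l] ab(2) that(1) ws(3) b(1) by simp
  qed
qed

lemma face_of_subset: "ws \<in> tracks \<Longrightarrow> face_of ws \<subseteq> V"
proof
  fix v assume ws: "ws \<in> tracks" and v: "v \<in> face_of ws"
  obtain i j where ij: "v = (i, j)" by (cases v)
  show "v \<in> V"
  proof (cases "v \<in> corners")
    case False
    then obtain s where s: "s \<le> N" "n + j = i + \<tau>1 + 1 + s" "int j + 1 \<in> set (ws ! s)"
      using v by (auto simp: face_of_def ij)
    then obtain l where "l < k" "ws ! s ! l = int j + 1"
      using tracksD(2)[OF ws s(1)] by (metis in_set_conv_nth)
    then have "int j + 1 \<le> int \<tau>1 + 1 + int s" "int j + 1 \<le> int m"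
      using tracksD(5,6)[OF ws s(1), of l] by auto
    then show ?thesis using s bounds by (auto simp: V_def ij)
  qed (auto simp: corners_def)
qed

lemma face_of_diag:
  assumes "ws \<in> tracks" "s \<le> N"
  shows "diag_cols (face_of ws) s = map (\<lambda>z. nat (z - 1)) (ws ! s)"
proof -
  have 1: "1 \<le> z \<and> int \<tau>1 + 2 + int s \<le> int n + z" if "z \<in> set (ws ! s)" for z
    using tracksD(2,5,6)[OF assms] that by (metis in_set_conv_nth)
  have "snd ` (face_of ws \<inter> diag s) = (\<lambda>z. nat (z - 1)) ` set (ws ! s)"
  proof (intro equalityI subsetI)
    fix j assume "j \<in> snd ` (face_of ws \<inter> diag s)"
    then obtain i where ij: "(i, j) \<in> face_of ws" "(i, j) \<in> diag s" by auto
    then have "int j + 1 \<in> set (ws ! s)"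
      using assms(2) by (auto simp: face_of_def diag_def corners_def)
    then show "j \<in> (\<lambda>z. nat (z - 1)) ` set (ws ! s)" by force
  next
    fix j assume "j \<in> (\<lambda>z. nat (z - 1)) ` set (ws ! s)"
    then obtain z where z: "z \<in> set (ws ! s)" "j = nat (z - 1)" by auto
    then have j: "int j + 1 = z" "\<tau>1 + 1 + s \<le> n + j" using 1[OF z(1)] by auto
    define i where "i = n + j - (\<tau>1 + 1 + s)"
    have "(i, j) \<in> face_of ws" using j z assms(2) by (auto simp: face_of_def i_def)
    moreover from this have "(i, j) \<in> diag s"
      using face_of_subset[OF assms(1)] j(2) by (auto simp: diag_def i_def)
    ultimately show "j \<in> snd ` (face_of ws \<inter> diag s)" by force
  qed
  moreover have "sorted_wrt (<) (map (\<lambda>z. nat (z - 1)) (ws ! s))"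
    unfolding sorted_wrt_map
    by (rule sorted_wrt_mono_rel[OF _ tracksD(3)[OF assms]]) (use 1 in force)
  ultimately show ?thesis
    unfolding diag_cols_def
    by (metis list.set_map sorted_list_of_set.idem_if_sorted_distinct strict_sorted_iff)
qed

lemma track_of_face_of: "ws \<in> tracks \<Longrightarrow> track_of (face_of ws) = ws"
proof (rule nth_equalityI)
  assume ws: "ws \<in> tracks"
  show "length (track_of (face_of ws)) = length ws" using tracksD(1)[OF ws] by (simp add: track_of_def)
  fix s assume "s < length (track_of (face_of ws))"
  then have s: "s \<le> N" by (simp add: track_of_def)
  have "1 \<le> z" if "z \<in> set (ws ! s)" for z
    using tracksD(2,5)[OF ws s] that by (metis in_set_conv_nth)
  then have "map (\<lambda>z. int (nat (z - 1)) + 1) (ws ! s) = ws ! s"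
    by (intro map_idI) force
  then show "track_of (face_of ws) ! s = ws ! s"
    using s by (simp add: track_of_def face_of_diag[OF ws s] comp_def del: upt_Suc)
qed

lemma card_face_of:
  assumes "ws \<in> tracks"
  shows "card (face_of ws) = top_card"
proof -
  have "card (face_of ws \<inter> diag s) = k" if "s \<le> N" for s
    using face_of_diag[OF assms that] tracksD(2)[OF assms that] by (metis diag_cols_facts(2) length_map)
  moreover have "face_of ws \<inter> corners = corners" by (auto simp: face_of_def)
  ultimately show ?thesis
    unfolding card_face[OF face_of_subset[OF assms]] top_card_def by simp
qed

lemma face_of_track_of:
  assumes F: "F \<subseteq> V" "corners \<subseteq> F"
  shows "face_of (track_of F) = F"
proof (intro equalityI subsetI)
  have tr: "track_of F ! s = map (\<lambda>j. int j + 1) (diag_cols F s)" if "s \<le> N" for s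
    using that by (simp add: track_of_def del: upt_Suc)
  have set: "set (diag_cols F s) = snd ` (F \<inter> diag s)" for s
    using finite_diag by (simp add: diag_cols_def)
  show "v \<in> F" if v: "v \<in> face_of (track_of F)" for v
  proof (cases "v \<in> corners")
    case False
    obtain i j where ij: "v = (i, j)" by (cases v)
    then obtain s where s: "s \<le> N" "n + j = i + \<tau>1 + 1 + s" "int j + 1 \<in> set (track_of F ! s)"
      using False v by (auto simp: face_of_def)
    then have "j \<in> set (diag_cols F s)" by (auto simp: tr[OF s(1)])
    then have "j \<in> snd ` (F \<inter> diag s)" by (simp only: set)
    then obtain i' where "(i', j) \<in> F" "n + j = i' + \<tau>1 + 1 + s" by (auto simp: diag_def)
    then show ?thesis using s(2) by (simp add: ij)
  qed (use F in auto)
  show "v \<in> face_of (track_of F)" if v: "v \<in> F" for v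
  proof (cases "v \<in> corners")
    case False
    then obtain s where s: "s \<le> N" "v \<in> diag s" using F v by (auto simp: corners_def)
    then have "snd v \<in> set (diag_cols F s)" using v by (auto simp: set)
    then show ?thesis using s by (auto simp: face_of_def diag_def tr image_iff)
  qed (auto simp: face_of_def)
qed

lemma track_of_in_tracks:
  assumes F: "F \<subseteq> V" "\<not> has_chain r F" "card F = top_card"
  shows "track_of F \<in> tracks"
proof -
  have tr: "track_of F ! s = map (\<lambda>j. int j + 1) (diag_cols F s)" if "s \<le> N" for s
    using that by (simp add: track_of_def del: upt_Suc)
  have len: "length (diag_cols F s) = k" if "s \<le> N" for s
    using card_face_eqD(2)[OF F that] by (simp add: diag_cols_facts(2))
  have mem: "\<exists>i. (i, j) \<in> diag s" if "j \<in> set (diag_cols F s)" for j s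
    using that finite_diag by (auto simp: diag_cols_def)
  have sorted: "sorted_wrt (<) (map (\<lambda>j. int j + 1) (diag_cols F s))" for s
    unfolding sorted_wrt_map by (rule sorted_wrt_mono_rel[OF _ diag_cols_facts(1)]) simp
  define a where "a = track_of F ! 0"
  define b where "b = map (\<lambda>z. z - (int m - 1 - int \<tau>2)) (track_of F ! N)"
  have "a \<in> starts"
    using len[of 0] sorted[of 0] mem[of _ 0]
    by (auto simp: a_def tr increasing_seqs_def diag_def V_def) fastforce
  moreover have "b \<in> ends"
  proof -
    have "int j + 1 - (int m - 1 - int \<tau>2) \<in> {1..int \<tau>2 + 1}" if "j \<in> set (diag_cols F N)" for j
      using mem[OF that] bounds(5) by (auto simp: diag_def V_def)
    then show ?thesis
      using len[of N] sorted[of N] unfolding b_def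
      by (auto simp: tr increasing_seqs_def sorted_wrt_map diag_cols_facts(1))
  qed
  moreover have "track_of F \<in> walks N a (shift b)"
    unfolding walks_iff
  proof (intro conjI allI impI)
    show "length (track_of F) = Suc N" by (simp add: track_of_def)
    show "track_of F ! 0 = a" by (simp add: a_def)
    show "track_of F ! N = shift b" by (simp add: b_def comp_def)
    fix s assume s: "s < N"
    have "diag_cols F (Suc s) ! i = diag_cols F s ! i \<or> diag_cols F (Suc s) ! i = Suc (diag_cols F s ! i)" if "i < k" for i
      using diag_cols_step[OF F(2) _ _ that, of s] card_face_eqD(2)[OF F] s by simp
    then show "one_step (track_of F ! s) (track_of F ! Suc s)"
      using s len[of s] len[of "Suc s"] sorted[of "Suc s"] by (fastforce simp: one_step_def tr)
  qed
  ultimately show ?thesis unfolding tracks_def by blast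
qed

section \<open>Faces of top dimension\<close>

text \<open>
  The \<open>l\<close>-th track is prolonged through the corners: down along column \<open>l\<close> before the first of the
  \<open>N + 1\<close> diagonals, and to the right along row \<open>l\<close> after the last one. The prolonged tracks cover the
  corners, so that the whole face is a disjoint union of lattice paths.
\<close>

definition "track_col ws l e =
  (if e \<le> \<tau>1 then l else if e \<le> \<tau>1 + 1 + N then nat (ws ! (e - (\<tau>1 + 1)) ! l - 1) else e + l - n)"

definition "cell ws l e = (n + track_col ws l e - e, track_col ws l e)"

text \<open>
  At a corner with \<open>t \<ge> r - 2\<close> nothing is prolonged; otherwise the prolongation ends at the border of the
  matrix or of the triangle of zeros, whichever comes first.
\<close>

definition "first_diag l = max t1 (min l \<tau>1) + 1"
definition "last_diag l = n + m - 1 - max t2 (min l \<tau>2)"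

lemma first_last: "first_diag l \<le> \<tau>1 + 1" "\<tau>1 + 1 + N \<le> last_diag l" "last_diag l + t2 < n + m" "t1 < first_diag l"
  using bounds by (auto simp: first_diag_def last_diag_def)

lemma track_col_eq:
  assumes "ws \<in> tracks" "l < k" "s \<le> N"
  shows "int (track_col ws l (\<tau>1 + 1 + s)) = ws ! s ! l - 1"
  using tracksD(5)[OF assms(1,3,2)] assms(3) by (simp add: track_col_def)

lemma region_cases:
  obtains "e \<le> \<tau>1" | s where "s \<le> N" "e = \<tau>1 + 1 + s" | "\<tau>1 + 1 + N < e"
proof -
  have "e \<le> \<tau>1 \<or> (\<exists>s\<le>N. e = \<tau>1 + 1 + s) \<or> \<tau>1 + 1 + N < e"
    by (metis Suc_eq_plus1 add_le_cancel_left le_Suc_ex not_less_eq_eq not_le)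
  then show thesis using that by blast
qed

lemma row_nonneg:
  assumes "ws \<in> tracks" "l < k"
  shows "e \<le> n + track_col ws l e"
proof (cases e rule: region_cases)
  case 1
  then show ?thesis using bounds by (simp add: track_col_def)
next
  case (2 s)
  then show ?thesis using track_col_eq[OF assms 2(1)] tracksD(6)[OF assms(1) 2(1) assms(2)] by simp
next
  case 3
  then show ?thesis using bounds by (simp add: track_col_def)
qed

text \<open>
  At the two joints the tracks fit together because the numbers \<open>a\<^sub>i\<close> (or \<open>b\<^sub>j\<close>) are forced to be
  \<open>1, \<dots>, r - 1\<close> there.
\<close>

lemma track_col_step:
  assumes "ws \<in> tracks" "l < k" "first_diag l \<le> e" "e < last_diag l"
  shows "track_col ws l (Suc e) = track_col ws l e \<or> track_col ws l (Suc e) = Suc (track_col ws l e)"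
proof (cases e rule: region_cases)
  case 1
  show ?thesis
  proof (cases "e = \<tau>1")
    case True
    then have "t1 < \<tau>1" using assms(3) by (auto simp: first_diag_def)
    then have "int (track_col ws l (\<tau>1 + 1 + 0)) = int l"
      using track_col_eq[OF assms(1,2), of 0] tracksD(7)[OF assms(1,2)] by simp
    then have "track_col ws l (Suc e) = l" using True by simp
    moreover have "track_col ws l e = l" using True by (simp add: track_col_def)
    ultimately show ?thesis by simp
  qed (use 1 in \<open>simp add: track_col_def\<close>)
next
  case (2 s)
  show ?thesis
  proof (cases "s = N")
    case True
    then have "t2 < \<tau>2" using assms(4) bounds(5) 2 by (auto simp: last_diag_def)
    then have "int (track_col ws l e) = int m - int \<tau>2 + int l - 1"
      using track_col_eq[OF assms(1,2), of N] tracksD(8)[OF assms(1,2)] 2 True by simp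
    moreover have "track_col ws l (Suc e) = Suc e + l - n" using 2 True by (simp add: track_col_def)
    ultimately show ?thesis using 2 True bounds by linarith
  next
    case False
    then have "s < N" using 2 by simp
    then show ?thesis
      using track_col_eq[OF assms(1,2), of s] track_col_eq[OF assms(1,2), of "Suc s"]
        tracksD(4)[OF assms(1) \<open>s < N\<close> assms(2)] 2 by auto
  qed
next
  case 3
  then show ?thesis using bounds by (auto simp: track_col_def)
qed

lemma track_col_first: "ws \<in> tracks \<Longrightarrow> l < k \<Longrightarrow> track_col ws l (first_diag l) < first_diag l"
proof -
  assume ws: "ws \<in> tracks" "l < k"
  show ?thesis
  proof (cases "first_diag l \<le> \<tau>1")
    case True
    then show ?thesis by (auto simp: track_col_def first_diag_def)
  next
    case False
    then have "first_diag l = \<tau>1 + 1 + 0" using first_last(1)[of l] by simp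
    then show ?thesis using track_col_eq[OF ws, of 0] tracksD(5)[OF ws(1) _ ws(2), of 0] by simp
  qed
qed

lemma track_col_last: "ws \<in> tracks \<Longrightarrow> l < k \<Longrightarrow> track_col ws l (last_diag l) < m"
proof -
  assume ws: "ws \<in> tracks" "l < k"
  show ?thesis
  proof (cases "\<tau>1 + 1 + N < last_diag l")
    case True
    then have "l < \<tau>2" using bounds by (auto simp: last_diag_def)
    then have "last_diag l + l < n + m" using bounds by (auto simp: last_diag_def)
    then show ?thesis using True bounds by (auto simp: track_col_def)
  next
    case False
    then have "last_diag l = \<tau>1 + 1 + N" using first_last(2)[of l] by simp
    then show ?thesis using track_col_eq[OF ws, of N] tracksD(6)[OF ws(1) _ ws(2), of N] by simp
  qed
qed

lemma cell_eq_iff: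
  assumes "ws \<in> tracks" "l < k"
  shows "(i, j) = cell ws l e \<longleftrightarrow> j = track_col ws l e \<and> n + j = i + e"
  using row_nonneg[OF assms, of e] by (auto simp: cell_def)

lemma track_col_inj:
  assumes "ws \<in> tracks" "l < k" "l' < k" "track_col ws l e = track_col ws l' e"
  shows "l = l'"
proof (cases e rule: region_cases)
  case (2 s)
  then have "ws ! s ! l = ws ! s ! l'"
    using track_col_eq[OF assms(1,2) 2(1)] track_col_eq[OF assms(1,3) 2(1)] assms(4) by simp
  then show ?thesis
    using tracksD(2,3)[OF assms(1) 2(1)] assms(2,3) by (simp add: strict_sorted_iff nth_eq_iff_index_eq)
qed (use assms bounds in \<open>auto simp: track_col_def\<close>)

lemma face_of_eq_cells:
  assumes "ws \<in> tracks"
  shows "face_of ws = (\<Union>l<k. cell ws l ` {first_diag l..last_diag l})"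
proof (intro equalityI subsetI)
  fix v assume v: "v \<in> face_of ws"
  obtain i j where ij: "v = (i, j)" by (cases v)
  have V: "(i, j) \<in> V" using face_of_subset[OF assms] v by (auto simp: ij)
  have "\<exists>l<k. \<exists>e \<in> {first_diag l..last_diag l}. (i, j) = cell ws l e"
  proof (cases "v \<in> corners")
    case True
    then consider "n + j \<le> i + \<tau>1" | "m + i \<le> j + \<tau>2" by (auto simp: ij corners_iff)
    then show ?thesis
    proof cases
      case 1
      then have e: "n + j - i \<le> \<tau>1" "t1 < n + j - i" "j < n + j - i" using V by (auto simp: V_def)
      then have j: "j < k" using short(1) by simp
      have "n + j - i \<in> {first_diag j..last_diag j}" using e first_last(2)[of j] by (auto simp: first_diag_def)
      moreover have "(i, j) = cell ws j (n + j - i)"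
        using e by (subst cell_eq_iff[OF assms j]) (auto simp: track_col_def)
      ultimately show ?thesis using j by blast
    next
      case 2
      then have e: "\<tau>1 + 1 + N < n + j - i" "n + j - i + t2 < n + m" "n + j - i + i < n + m" "i < \<tau>2" "t2 < \<tau>2"
        using V bounds by (auto simp: V_def)
      then have i: "i < k" using short(2) by simp
      have "n + j - i \<in> {first_diag i..last_diag i}" using e first_last(1)[of i] by (auto simp: last_diag_def)
      moreover have "(i, j) = cell ws i (n + j - i)"
        using e V by (subst cell_eq_iff[OF assms i]) (auto simp: track_col_def V_def)
      ultimately show ?thesis using i by blast
    qed
  next
    case False
    then obtain s where s: "s \<le> N" "n + j = i + \<tau>1 + 1 + s" "int j + 1 \<in> set (ws ! s)"
      using v by (auto simp: face_of_def ij)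
    then obtain l where l: "l < k" "ws ! s ! l = int j + 1"
      using tracksD(2)[OF assms s(1)] by (metis in_set_conv_nth)
    then have "(i, j) = cell ws l (\<tau>1 + 1 + s)"
      using track_col_eq[OF assms l(1) s(1)] s(2) by (simp add: cell_eq_iff[OF assms l(1)])
    moreover have "\<tau>1 + 1 + s \<in> {first_diag l..last_diag l}" using first_last(1,2)[of l] s(1) by auto
    ultimately show ?thesis using l(1) by blast
  qed
  then show "v \<in> (\<Union>l<k. cell ws l ` {first_diag l..last_diag l})" by (auto simp: ij)
next
  fix v assume "v \<in> (\<Union>l<k. cell ws l ` {first_diag l..last_diag l})"
  then obtain l e where l: "l < k" and e: "first_diag l \<le> e" "e \<le> last_diag l" and v: "v = cell ws l e" by auto
  obtain i j where ij: "v = (i, j)" by (cases v)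
  have j: "j = track_col ws l e" "n + j = i + e" using v unfolding ij cell_eq_iff[OF assms l] by auto
  show "v \<in> face_of ws"
  proof (cases e rule: region_cases)
    case 1
    then have "t1 < e" "l < e" "j = l" using e(1) j by (auto simp: first_diag_def track_col_def)
    then have "v \<in> corners"
      using 1 j bounds l by (auto simp: ij corners_iff V_def)
    then show ?thesis by (simp add: face_of_def)
  next
    case (2 s)
    have "int j + 1 = ws ! s ! l" using track_col_eq[OF assms l 2(1)] j 2 by simp
    then have "int j + 1 \<in> set (ws ! s)" using tracksD(2)[OF assms 2(1)] l by simp
    then show ?thesis using 2 j by (auto simp: face_of_def ij)
  next
    case 3
    then have e': "e + l < n + m" "e + t2 < n + m" "l < \<tau>2" using e(2) bounds by (auto simp: last_diag_def)
    have "j = e + l - n" using 3 j by (simp add: track_col_def)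
    then have "i = l" "j + n = e + l" using j 3 bounds by auto
    then have "v \<in> corners"
      using 3 e' bounds by (auto simp: ij corners_iff V_def)
    then show ?thesis by (simp add: face_of_def)
  qed
qed

text \<open>
  The bounding box of a prolonged track avoids both triangles of zeros, because these are cut off by
  diagonals and the box has its extreme corners, where \<open>i - j\<close> and \<open>j - i\<close> are largest, on the track.
\<close>

lemma face_of_not_in_initial_ideal:
  assumes "ws \<in> tracks"
  shows "(\<Prod>v \<in> face_of ws. indet v :: 'k::field pring) \<notin>
    initial_ideal V (minor_ideal V r (generic_matrix n m V))"
proof -
  define p where "p = (\<lambda>l s. cell ws l (first_diag l + s))"
  define L where "L = (\<lambda>l. last_diag l - first_diag l)"
  have fl: "first_diag l \<le> last_diag l" for l using first_last(1,2)[of l] by linarith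
  have img: "p l ` {..L l} = cell ws l ` {first_diag l..last_diag l}" for l
  proof -
    have "{first_diag l..last_diag l} = (+) (first_diag l) ` {..L l}"
      using fl[of l] by (simp add: L_def atMost_atLeast0)
    then show ?thesis by (simp only: image_image p_def)
  qed
  have ends: "p l 0 = cell ws l (first_diag l)" "p l (L l) = cell ws l (last_diag l)" for l
    using fl[of l] by (simp_all add: p_def L_def)
  have "lattice_path (p l) (L l)" if l: "l < k" for l
    unfolding lattice_path_def
  proof (intro allI impI)
    fix s assume "s < L l"
    then have s: "first_diag l \<le> first_diag l + s" "first_diag l + s < last_diag l" by (auto simp: L_def)
    show "p l (Suc s) = (fst (p l s), Suc (snd (p l s))) \<or> p l s = (Suc (fst (p l (Suc s))), snd (p l (Suc s)))"
      using track_col_step[OF assms l s] row_nonneg[OF assms l, of "first_diag l + s"]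
        row_nonneg[OF assms l, of "Suc (first_diag l + s)"]
      by (auto simp: p_def cell_def)
  qed
  moreover have "{fst (p l (L l))..fst (p l 0)} \<times> {snd (p l 0)..snd (p l (L l))} \<subseteq> V" if l: "l < k" for l
    using track_col_first[OF assms l] track_col_last[OF assms l] first_last(3,4)[of l]
      row_nonneg[OF assms l, of "first_diag l"] row_nonneg[OF assms l, of "last_diag l"]
    unfolding ends by (auto simp: cell_def V_def)
  moreover have "p l ` {..L l} \<inter> p l' ` {..L l'} = {}" if "l < k" "l' < k" "l \<noteq> l'" for l l'
  proof -
    have "l = l'" if "cell ws l e = cell ws l' e'" for e e'
    proof -
      obtain i j where ij: "(i, j) = cell ws l e" by (metis surj_pair)
      then have "j = track_col ws l e" "j = track_col ws l' e'" "n + j = i + e" "n + j = i + e'"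
        using that cell_eq_iff[OF assms \<open>l < k\<close>, of i j e] cell_eq_iff[OF assms \<open>l' < k\<close>, of i j e'] by auto
      then show ?thesis using track_col_inj[OF assms \<open>l < k\<close> \<open>l' < k\<close>, of e] by simp
    qed
    then show ?thesis using \<open>l \<noteq> l'\<close> unfolding img by blast
  qed
  moreover have "k < r" using bounds(8) by simp
  ultimately have "(\<Prod>v \<in> (\<Union>l<k. p l ` {..L l}). indet v :: 'k pring) \<notin>
      initial_ideal V (minor_ideal V r (generic_matrix n m V))"
    by (rule path_union_not_in_initial_ideal)
  then show ?thesis unfolding img face_of_eq_cells[OF assms] .
qed

text \<open>
  Needed to know that the bound \<open>top_card\<close> is attained, hence that it determines the dimension. All
  particles of the witness move at once during the first \<open>m - 1 - T\<^sub>2\<close> steps and then rest.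
\<close>

lemma tracks_nonempty: "tracks \<noteq> {}"
proof -
  define D where "D = m - 1 - \<tau>2"
  define a where "a = map (\<lambda>l. int l + 1) [0..<k]"
  define ws where "ws = map (\<lambda>s. map (\<lambda>z. z + int (min s D)) a) [0..<Suc N]"
  have D: "D \<le> N" "int D = int m - 1 - int \<tau>2" using bounds by (auto simp: D_def)
  have a: "a \<in> increasing_seqs k M" if "int k \<le> M" for M
    using that by (auto simp: a_def increasing_seqs_def sorted_wrt_iff_nth_less)
  have nth: "ws ! s = map (\<lambda>z. z + int (min s D)) a" if "s \<le> N" for s
    using that by (simp add: ws_def del: upt_Suc)
  have sorted: "sorted_wrt (<) (map (\<lambda>z. z + c) a)" for c
    by (auto simp: a_def sorted_wrt_iff_nth_less)
  have "ws \<in> walks N a (shift a)"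
    unfolding walks_iff
  proof (intro conjI allI impI)
    show "length ws = Suc N" by (simp add: ws_def)
    show "ws ! 0 = a" by (simp add: nth)
    show "ws ! N = shift a" using D by (simp add: nth min_def)
    fix s assume "s < N"
    then show "one_step (ws ! s) (ws ! Suc s)"
      using sorted[of "int (min (Suc s) D)"] by (auto simp: one_step_def nth min_def)
  qed
  moreover have "a \<in> starts" "a \<in> ends" using bounds by (auto intro!: a)
  ultimately show ?thesis unfolding tracks_def by blast
qed

lemma card_tracks:
  "int (card tracks) = (\<Sum>a \<in> starts. \<Sum>b \<in> ends.
     det (mat k k (\<lambda>(i, j). h_entry (int n) (int m) (int \<tau>1) (int \<tau>2) (a ! i) (b ! j))))"
proof -
  have seq: "length a = k" "sorted_wrt (<) a" if "a \<in> increasing_seqs k M" for a M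
    using that by (auto simp: increasing_seqs_def)
  have h: "h_entry (int n) (int m) (int \<tau>1) (int \<tau>2) x y = step_binom N (int m - 1 - int \<tau>2 + y - x)" for x y
  proof -
    have N: "nat (int n + int m - int \<tau>1 - int \<tau>2 - 2) = N" using bounds(5) by linarith
    have "N choose nat (int m - 1 - int \<tau>2 + y - x) = 0" if "y - x > int n - 1 - int \<tau>1"
      using that bounds(5) by (intro binomial_eq_0) linarith
    then show ?thesis unfolding h_entry_def step_binom_def N by auto
  qed
  have "card tracks = (\<Sum>(a, b) \<in> starts \<times> ends. card (walks N a (shift b)))"
    unfolding tracks_def case_prod_unfold
  proof (rule card_UN_disjoint)
    show "finite (starts \<times> ends)" by (simp add: finite_increasing_seqs)
    show "\<forall>ab \<in> starts \<times> ends. finite (walks N (fst ab) (shift (snd ab)))"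
      using seq(2) by (auto intro!: finite_walks)
    show "\<forall>ab \<in> starts \<times> ends. \<forall>ab' \<in> starts \<times> ends. ab \<noteq> ab' \<longrightarrow>
        walks N (fst ab) (shift (snd ab)) \<inter> walks N (fst ab') (shift (snd ab')) = {}"
    proof (intro ballI impI)
      fix ab ab' :: "int list \<times> int list" assume "ab \<noteq> ab'"
      moreover have "inj (map ((+) (int m - 1 - int \<tau>2)))" by (intro inj_mapI) simp
      ultimately show "walks N (fst ab) (shift (snd ab)) \<inter> walks N (fst ab') (shift (snd ab')) = {}"
        by (auto simp: walks_iff prod_eq_iff dest!: injD)
    qed
  qed
  then have "int (card tracks) = (\<Sum>a \<in> starts. \<Sum>b \<in> ends. int (card (walks N a (shift b))))"
    by (simp add: sum.cartesian_product case_prod_unfold)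
  also have "\<dots> = (\<Sum>a \<in> starts. \<Sum>b \<in> ends.
     det (mat k k (\<lambda>(i, j). h_entry (int n) (int m) (int \<tau>1) (int \<tau>2) (a ! i) (b ! j))))"
  proof (intro sum.cong refl)
    fix a b assume ab: "a \<in> starts" "b \<in> ends"
    have "int (card (walks N a (shift b))) = det (mat k k (\<lambda>(i, j). step_binom N (shift b ! j - a ! i)))"
      using seq[OF ab(1)] seq[OF ab(2)] by (intro card_walks_eq_det) (auto simp: sorted_wrt_map)
    also have "mat k k (\<lambda>(i, j). step_binom N (shift b ! j - a ! i)) =
        mat k k (\<lambda>(i, j). h_entry (int n) (int m) (int \<tau>1) (int \<tau>2) (a ! i) (b ! j))"
      using seq(1)[OF ab(2)] by (intro eq_matI) (auto simp: h)
    finally show "int (card (walks N a (shift b))) =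
        det (mat k k (\<lambda>(i, j). h_entry (int n) (int m) (int \<tau>1) (int \<tau>2) (a ! i) (b ! j)))" .
  qed
  finally show ?thesis .
qed

text \<open>
  Chain-free sets have at most \<open>top_card\<close> elements, and those that attain the bound are exactly the
  sets described by \<open>tracks\<close>, all of which are faces.
\<close>

lemma face_number_top:
  fixes \<Delta> :: "(nat \<times> nat) set set"
  defines "\<Delta> \<equiv> initial_complex V (minor_ideal V r (generic_matrix n m V) :: 'k::field pring set)"
  shows "face_number (complex_dim \<Delta>) \<Delta> = card tracks"
proof -
  have chain_free: "F \<subseteq> V" "\<not> has_chain r F" if "F \<in> \<Delta>" for F
  proof -
    show "F \<subseteq> V" using that by (simp add: \<Delta>_def initial_complex_def)
    show "\<not> has_chain r F"
    proof
      assume "has_chain r F"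
      then obtain f g where "\<And>a b. a < b \<Longrightarrow> b < r \<Longrightarrow> f a < f b" "\<And>a b. a < b \<Longrightarrow> b < r \<Longrightarrow> g a < g b"
        "\<And>a. a < r \<Longrightarrow> (f a, g a) \<in> F"
        unfolding has_chain_def by blast
      moreover have "V \<subseteq> {..<n} \<times> {..<m}" by (auto simp: V_def)
      ultimately have "(\<Prod>v\<in>F. indet v :: 'k pring) \<in> initial_ideal V (minor_ideal V r (generic_matrix n m V))"
        using \<open>F \<subseteq> V\<close> by (intro chain_in_initial_ideal[where f = f and g = g]) auto
      then show False using that by (simp add: \<Delta>_def initial_complex_def)
    qed
  qed
  have face_of: "face_of ws \<in> \<Delta>" if "ws \<in> tracks" for ws
    using face_of_subset[OF that] face_of_not_in_initial_ideal[OF that, where ?'k = 'k]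
    by (simp add: \<Delta>_def initial_complex_def)
  have top: "{F \<in> \<Delta>. card F = top_card} = face_of ` tracks"
  proof (intro equalityI subsetI)
    fix F assume "F \<in> {F \<in> \<Delta>. card F = top_card}"
    then have F: "F \<subseteq> V" "\<not> has_chain r F" "card F = top_card" using chain_free by auto
    then show "F \<in> face_of ` tracks"
      using face_of_track_of[OF F(1) card_face_eqD(1)[OF F]] track_of_in_tracks[OF F] by (metis imageI)
  qed (auto simp: face_of card_face_of)
  have "\<Delta> \<subseteq> Pow V" using chain_free(1) by blast
  then have fin: "finite \<Delta>" by (rule finite_subset) (simp add: finite_V)
  obtain ws where ws: "ws \<in> tracks" using tracks_nonempty by blast
  have dim: "complex_dim \<Delta> = int top_card - 1"
    unfolding complex_dim_def
  proof (rule Max_eqI)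
    show "finite (face_dim ` \<Delta>)" using fin by simp
    show "d \<le> int top_card - 1" if d: "d \<in> face_dim ` \<Delta>" for d
    proof -
      obtain F where "F \<in> \<Delta>" "d = face_dim F" using d by blast
      then show ?thesis using card_face_le[OF chain_free[OF \<open>F \<in> \<Delta>\<close>]] by (simp add: face_dim_def)
    qed
    show "int top_card - 1 \<in> face_dim ` \<Delta>"
      using face_of[OF ws] card_face_of[OF ws] by (force simp: face_dim_def)
  qed
  have "face_number (complex_dim \<Delta>) \<Delta> = card {F \<in> \<Delta>. card F = top_card}"
    unfolding face_number_def dim face_dim_def by simp
  also have "\<dots> = card tracks"
    unfolding top using track_of_face_of by (intro card_image inj_on_inverseI)
  finally show ?thesis .
qed

end

lemma triangle_size_less:
  assumes "gd_shape n m c d" "triangle1 t1 c" "triangle2 t2 d" "0 < n"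
  shows "t1 < n" "t1 < m" "t2 < n" "t2 < m"
proof -
  have c: "length c = t1" "\<And>i. i < t1 \<Longrightarrow> c ! i = t1 - i" and d: "length d = t2" "\<And>i. i < t2 \<Longrightarrow> d ! i = i + 1"
    using assms(2,3) by (auto simp: triangle1_def triangle2_def)
  have less: "\<forall>x \<in> set c. x < n" "\<forall>x \<in> set d. x < n"
    using assms(1) by (auto simp: gd_shape_def)
  show "t1 < m" "t2 < m" using assms(1) c(1) d(1) by (auto simp: gd_shape_def)
  show "t1 < n"
  proof (cases "t1 = 0")
    case False
    then have "c ! 0 < n" using less(1) c(1) by simp
    then show ?thesis using c(2)[of 0] False by simp
  qed (use assms(4) in simp)
  show "t2 < n"
  proof (cases "t2 = 0")
    case False
    then have "d ! (t2 - 1) < n" using less(2) d(1) by simp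
    then show ?thesis using d(2)[of "t2 - 1"] False by simp
  qed (use assms(4) in simp)
qed

lemma nonzero_entries_triangles:
  assumes "gd_shape n m c d" "triangle1 t1 c" "triangle2 t2 d" "0 < n"
  shows "nonzero_entries n m c d = {(i, j). i < n \<and> j < m \<and> i + t1 < n + j \<and> j + t2 < m + i}"
proof -
  have c: "length c = t1" "\<And>i. i < t1 \<Longrightarrow> c ! i = t1 - i" and d: "length d = t2" "\<And>i. i < t2 \<Longrightarrow> d ! i = i + 1"
    using assms(2,3) by (auto simp: triangle1_def triangle2_def)
  note t1 = triangle_size_less(1)[OF assms] and t2 = triangle_size_less(4)[OF assms]
  have "(i, j) \<in> ladder1 n c \<longleftrightarrow> i < n \<and> n + j \<le> i + t1" if "i < n" for i j
    using that c t1 by (cases "j < t1") (auto simp: ladder1_def)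
  moreover have "(i, j) \<in> ladder2 m d \<longleftrightarrow> m + i \<le> j + t2" if "j < m" for i j
    using that d(1) d(2)[of "j - (m - t2)"] t2 by (cases "m - t2 \<le> j") (auto simp: ladder2_def)
  ultimately show ?thesis by (auto simp: nonzero_entries_def)
qed

theorem lemma6p5:
  fixes n m r t1 t2 :: nat
    and c d :: "nat list"
    and X :: "'k::field pring mat"
    and V :: "(nat \<times> nat) set"
    and I :: "'k pring set"
    and \<Delta> :: "(nat \<times> nat) set set"
    and T1 T2 :: int
  assumes "gd_shape n m c d"
    and "triangle1 t1 c"
    and "triangle2 t2 d"
    and "1 \<le> r" and "r \<le> min n m"
    and "V = nonzero_entries n m c d"
    and "X = generic_gd_matrix n m c d"
    and "I = minor_ideal V r X"
    and "\<Delta> = initial_complex V I"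
    and "T1 = max (int r - 2) (int t1)"
    and "T2 = max (int r - 2) (int t2)"
  shows "int (face_number (complex_dim \<Delta>) \<Delta>) =
    (\<Sum>a \<in> increasing_seqs (r - 1) (T1 + 1). \<Sum>b \<in> increasing_seqs (r - 1) (T2 + 1).
       det (mat (r - 1) (r - 1) (\<lambda>(i, j). h_entry (int n) (int m) T1 T2 (a ! i) (b ! j))))"
proof -
  have "0 < n" using assms(4,5) by simp
  then interpret S: triangle_shape n m r t1 t2
    using assms(4,5) triangle_size_less[OF assms(1-3)] by unfold_locales auto
  have V: "V = S.V"
    unfolding assms(6) nonzero_entries_triangles[OF assms(1-3) \<open>0 < n\<close>] S.V_def ..
  have X: "X = generic_matrix n m S.V"
    unfolding assms(7) generic_gd_matrix_def generic_matrix_def V[symmetric] assms(6) ..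
  have T: "T1 = int S.\<tau>1" "T2 = int S.\<tau>2" "r - 1 = S.k"
    using assms(4) by (auto simp: assms(10,11) S.\<tau>1_def S.\<tau>2_def S.k_def)
  have "\<Delta> = initial_complex S.V (minor_ideal S.V r (generic_matrix n m S.V) :: 'k pring set)"
    unfolding assms(8,9) X V ..
  then have "int (face_number (complex_dim \<Delta>) \<Delta>) = int (card S.tracks)"
    using S.face_number_top[where ?'k = 'k] by simp
  then show ?thesis unfolding S.card_tracks T .
qed

end
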